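(* Let $(H,\alpha,i):(\mathcal O_{\mathcal C},\mathcal C,\mathbf 2_{\mathcal C},\iota_{\mathcal C})\to(\mathcal O_{\mathcal D},\mathcal D,\mathbf 2_{\mathcal D},\iota_{\mathcal D})$ be an SFC-functor between SFC-categories. Let $\zeta^H_X:H\Omega_{\mathcal C}X\to\Omega_{\mathcal D}X$ ($X\in\mathbf{Top}_{\mathcal C}$) be the morphism of $\mathcal D$ whose underlying function is $|\mathcal O_{\mathcal D}\zeta^H_X|=\theta_{\mathcal D,X}^{-1}\circ\theta_{\mathcal C,X}\circ|\alpha_{\Omega_{\mathcal C}X}|$, and let $\xi^H_C:\mathsf{pt}_{\mathcal C}C\to\mathsf{pt}_{\mathcal D}HC$ ($C\in\mathcal C$) be the continuous map $f\mapsto i\circ H(f)$. Then the functor $H:\mathcal C\to\mathcal D$, the inclusion $\mathbf{Top}_{\mathcal C}^{\mathrm{op}}\hookrightarrow\mathbf{Top}_{\mathcal D}^{\mathrm{op}}$, and the natural transformations $\zeta^H$, $\xi^H$ constitute a right adjunction morphism from the adjunction $\mathsf{pt}_{\mathcal C}\dashv\Omega_{\mathcal C}$ to the adjunction $\mathsf{pt}_{\mathcal D}\dashv\Omega_{\mathcal D}$.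
   Context: $\mathbf{Frm}$ is the category of frames and frame homomorphisms, $\mathbf 2=\{0<1\}$, $\mathbf{Top}$ the category of topological spaces, $\mathbb S$ the Sierpinski space ($\{0,1\}$ with opens $\emptyset,\{1\},\{0,1\}$); $|\cdot|$ denotes underlying sets and functions. Lifts. Let $U:\mathcal A\to\mathcal B$ be a faithful functor. A morphism $f:U(A)\to U(A')$ lifts if $f=U(p)$ for a (unique) $p$, its lift. A cartesian lift w.r.t. $U$ of a family $\{f_i:X\to U(C)\}$ is a pair $(\overline X,\theta)$, $\overline X\in\mathcal A$, $\theta:U(\overline X)\to X$ an isomorphism, such that for every $D$ a morphism $h:U(D)\to U(\overline X)$ lifts iff every $f_i\theta h$ lifts. A PFC-category is a quadruple $(\mathcal O_{\mathcal C},\mathcal C,\mathbf 2_{\mathcal C},\iota_{\mathcal C})$ with $\mathcal O_{\mathcal C}:\mathcal C\to\mathbf{Frm}$ faithful, $\mathbf 2_{\mathcal C}\in\mathcal C$, $\iota_{\mathcal C}:\mathcal O_{\mathcal C}(\mathbf 2_{\mathcal C})\to\mathbf 2$ an isomorphism. $\mathbf{Top}_{\mathcal C}$ is the full subcategory of $\mathbf{Top}$ of spaces $X$ for which the family $\{|\iota_{\mathcal C}^{-1}|\circ\chi_x:\mathbf{Top}(X,\mathbb S)\to|\mathcal O_{\mathcal C}(\mathbf 2_{\mathcal C})|\mid x\in X\}$, $\chi_x(g)=g(x)$, has a cartesian lift $(\Omega_{\mathcal C}X,\theta_{\mathcal C,X})$ w.r.t. $|\mathcal O_{\mathcal C}(-)|:\mathcal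 C\to\mathbf{Set}$; $\overline{\chi_x}$ is the lift of $|\iota_{\mathcal C}^{-1}|\circ\chi_x\circ\theta_{\mathcal C,X}$. $\mathsf{pt}_{\mathcal C}(C)$ is the set $\mathcal C(C,\mathbf 2_{\mathcal C})$ with opens $\{f\mid\iota_{\mathcal C}(\mathcal O_{\mathcal C}f(a))=1\}$, $a\in\mathcal O_{\mathcal C}(C)$. It is an SFC-category if $\mathbb S\in\mathbf{Top}_{\mathcal C}$ and $\mathsf{pt}_{\mathcal C}(C)\in\mathbf{Top}_{\mathcal C}$ for all $C$. Then there is an adjunction $\mathsf{pt}_{\mathcal C}\dashv\Omega_{\mathcal C}$ between $\mathcal C$ and $\mathbf{Top}_{\mathcal C}^{\mathrm{op}}$: $\mathsf{pt}_{\mathcal C}$ acts by precomposition, $\Omega_{\mathcal C}$ sends $f:X\to Y$ to the lift of $\theta_{\mathcal C,X}^{-1}\circ(-\circ f)\circ\theta_{\mathcal C,Y}$, with units $\sigma^{\mathcal C}_X:x\mapsto\overline{\chi_x}$ and $\eta^{\mathcal C}_C:C\to\Omega_{\mathcal C}\mathsf{pt}_{\mathcal C}C$ determined by $\theta\circ|\mathcal O_{\mathcal C}\eta^{\mathcal C}_C|(a)=(f\mapsto\iota_{\mathcal C}(\mathcal O_{\mathcal C}f(a)))$. A PFC-functor $(H,\alpha,i)$ consists of a functor $H:\mathcal C\to\mathcal D$, a natural isomorphism $\alpha:\mathcal O_{\mathcal D}H\to\mathcal O_{\mathcal C}$ and an isomorphism $i:H(\mathbf 2_{\mathcal C})\to\mathbf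 2_{\mathcal D}$ with $\iota_{\mathcal D}\circ\mathcal O_{\mathcal D}(i)=\iota_{\mathcal C}\circ\alpha_{\mathbf 2_{\mathcal C}}$. An SFC-functor is a PFC-functor between SFC-categories such that (M3): for each $X\in\mathbf{Top}_{\mathcal C}$, the cartesian lift $(\Omega_{\mathcal C}X,\theta_{\mathcal C,X})$ is preserved, i.e. $(H\Omega_{\mathcal C}X,\theta_{\mathcal C,X}\circ|\alpha_{\Omega_{\mathcal C}X}|)$ is a cartesian lift w.r.t. $|\mathcal O_{\mathcal D}(-)|$ of the family $\{|\alpha_{\mathbf 2_{\mathcal C}}^{-1}|\circ|\iota_{\mathcal C}^{-1}|\circ\chi_x:\mathbf{Top}(X,\mathbb S)\to|\mathcal O_{\mathcal D}H(\mathbf 2_{\mathcal C})|\mid x\in X\}$. For an SFC-functor one has $\mathbf{Top}_{\mathcal C}\subseteq\mathbf{Top}_{\mathcal D}$. Right adjunction morphisms. Given adjunctions $F\dashv G$ ($F:\mathcal A\to\mathcal B$, unit $\eta$) and $P\dashv Q$ ($P:\mathcal C'\to\mathcal D'$, counit $\delta$) and functors $U:\mathcal A\to\mathcal C'$, $V:\mathcal B\to\mathcal D'$, natural transformations $\zeta:UG\to QV$ and $\xi:PU\to VF$ are a mate-pair if $\xi=\delta_{VF}\circ P\zeta_F\circ PU\eta$. $(U,V,\zeta,\xi)$ is a right adjunction morphism if $\zeta,\xi$ are a mate-pair and $\zeta$ is invertible. (Here $\xi^H$ is a natural transformation in $\mathbf{Top}_{\mathcal D}^{\mathrm{op}}$.)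 *)

theory Defs
  imports "HOL-Algebra.Complete_Lattice" "HOL-Analysis.Abstract_Topology"
begin

section \<open>Categories, functors, natural transformations\<close>

record ('o, 'a) cat =
  Obj :: "'o set"
  Arr :: "'a set"
  Dom :: "'a \<Rightarrow> 'o"
  Cod :: "'a \<Rightarrow> 'o"
  Ide :: "'o \<Rightarrow> 'a"
  Comp :: "'a \<Rightarrow> 'a \<Rightarrow> 'a"

text \<open>\<open>Comp C g f\<close> is \<open>g\<close> after \<open>f\<close>.\<close>

definition Hom :: "('o, 'a) cat \<Rightarrow> 'o \<Rightarrow> 'o \<Rightarrow> 'a set" where
  "Hom C a b = {f \<in> Arr C. Dom C f = a \<and> Cod C f = b}"

locale category =
  fixes C :: "('o, 'a) cat"
  assumes dom_obj: "f \<in> Arr C \<Longrightarrow> Dom C f \<in> Obj C"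
    and cod_obj: "f \<in> Arr C \<Longrightarrow> Cod C f \<in> Obj C"
    and ide_hom: "a \<in> Obj C \<Longrightarrow> Ide C a \<in> Hom C a a"
    and comp_hom: "\<lbrakk>f \<in> Hom C a b; g \<in> Hom C b c\<rbrakk> \<Longrightarrow> Comp C g f \<in> Hom C a c"
    and comp_ide_right: "f \<in> Hom C a b \<Longrightarrow> Comp C f (Ide C a) = f"
    and comp_ide_left: "f \<in> Hom C a b \<Longrightarrow> Comp C (Ide C b) f = f"
    and comp_assoc: "\<lbrakk>f \<in> Hom C a b; g \<in> Hom C b c; h \<in> Hom C c d\<rbrakk>
      \<Longrightarrow> Comp C h (Comp C g f) = Comp C (Comp C h g) f"

definition op_cat :: "('o, 'a) cat \<Rightarrow> ('o, 'a) cat" where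
  "op_cat C = \<lparr>Obj = Obj C, Arr = Arr C, Dom = Cod C, Cod = Dom C, Ide = Ide C,
     Comp = (\<lambda>g f. Comp C f g)\<rparr>"

definition full_subcat :: "('o, 'a) cat \<Rightarrow> 'o set \<Rightarrow> ('o, 'a) cat" where
  "full_subcat C S = \<lparr>Obj = Obj C \<inter> S, Arr = {f \<in> Arr C. Dom C f \<in> S \<and> Cod C f \<in> S},
     Dom = Dom C, Cod = Cod C, Ide = Ide C, Comp = Comp C\<rparr>"

definition iso_arr :: "('o, 'a) cat \<Rightarrow> 'a \<Rightarrow> bool" where
  "iso_arr C f \<longleftrightarrow> f \<in> Arr C \<and>
     (\<exists>g \<in> Hom C (Cod C f) (Dom C f).
        Comp C g f = Ide C (Dom C f) \<and> Comp C f g = Ide C (Cod C f))"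

record ('o, 'a, 'p, 'b) cfunctor =
  FObj :: "'o \<Rightarrow> 'p"
  FArr :: "'a \<Rightarrow> 'b"

locale is_functor = source: category A + target: category B
  for A :: "('o, 'a) cat" and B :: "('p, 'b) cat" +
  fixes F :: "('o, 'a, 'p, 'b) cfunctor"
  assumes map_obj: "a \<in> Obj A \<Longrightarrow> FObj F a \<in> Obj B"
    and map_hom: "f \<in> Hom A a b \<Longrightarrow> FArr F f \<in> Hom B (FObj F a) (FObj F b)"
    and map_ide: "a \<in> Obj A \<Longrightarrow> FArr F (Ide A a) = Ide B (FObj F a)"
    and map_comp: "\<lbrakk>f \<in> Hom A a b; g \<in> Hom A b c\<rbrakk>
      \<Longrightarrow> FArr F (Comp A g f) = Comp B (FArr F g) (FArr F f)"

definition faithful :: "('o, 'a) cat \<Rightarrow> ('o, 'a, 'p, 'b) cfunctor \<Rightarrow> bool" where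
  "faithful A F \<longleftrightarrow> (\<forall>a \<in> Obj A. \<forall>b \<in> Obj A. inj_on (FArr F) (Hom A a b))"

definition id_functor :: "('o, 'a, 'o, 'a) cfunctor" where
  "id_functor = \<lparr>FObj = (\<lambda>a. a), FArr = (\<lambda>f. f)\<rparr>"

definition comp_functor ::
  "('p, 'b, 'q, 'c) cfunctor \<Rightarrow> ('o, 'a, 'p, 'b) cfunctor \<Rightarrow> ('o, 'a, 'q, 'c) cfunctor" where
  "comp_functor G F = \<lparr>FObj = (\<lambda>a. FObj G (FObj F a)), FArr = (\<lambda>f. FArr G (FArr F f))\<rparr>"

locale nat_trans = source: is_functor A B F + target: is_functor A B G
  for A :: "('o, 'a) cat" and B :: "('p, 'b) cat"
    and F :: "('o, 'a, 'p, 'b) cfunctor" and G :: "('o, 'a, 'p, 'b) cfunctor" +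
  fixes \<tau> :: "'o \<Rightarrow> 'b"
  assumes component: "a \<in> Obj A \<Longrightarrow> \<tau> a \<in> Hom B (FObj F a) (FObj G a)"
    and natural: "f \<in> Hom A a b
      \<Longrightarrow> Comp B (\<tau> b) (FArr F f) = Comp B (FArr G f) (\<tau> a)"

definition nat_iso where
  "nat_iso A B F G \<tau> \<longleftrightarrow> nat_trans A B F G \<tau> \<and> (\<forall>a \<in> Obj A. iso_arr B (\<tau> a))"


section \<open>Adjunctions and right adjunction morphisms\<close>

record ('o, 'a, 'p, 'b) adj =
  LCat :: "('o, 'a) cat"
  RCat :: "('p, 'b) cat"
  LAdj :: "('o, 'a, 'p, 'b) cfunctor"
  RAdj :: "('p, 'b, 'o, 'a) cfunctor"
  Unit :: "'o \<Rightarrow> 'a"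
  Counit :: "'p \<Rightarrow> 'b"

definition adjunction :: "('o, 'a, 'p, 'b) adj \<Rightarrow> bool" where
  "adjunction T \<longleftrightarrow>
     is_functor (LCat T) (RCat T) (LAdj T) \<and>
     is_functor (RCat T) (LCat T) (RAdj T) \<and>
     nat_trans (LCat T) (LCat T) id_functor (comp_functor (RAdj T) (LAdj T)) (Unit T) \<and>
     nat_trans (RCat T) (RCat T) (comp_functor (LAdj T) (RAdj T)) id_functor (Counit T) \<and>
     (\<forall>a \<in> Obj (LCat T).
        Comp (RCat T) (Counit T (FObj (LAdj T) a)) (FArr (LAdj T) (Unit T a))
          = Ide (RCat T) (FObj (LAdj T) a)) \<and>
     (\<forall>b \<in> Obj (RCat T).
        Comp (LCat T) (FArr (RAdj T) (Counit T b)) (Unit T (FObj (RAdj T) b))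
          = Ide (LCat T) (FObj (RAdj T) b))"

definition mate_pair ::
  "('o, 'a, 'p, 'b) adj \<Rightarrow> ('q, 'c, 'r, 'd) adj \<Rightarrow>
   ('o, 'a, 'q, 'c) cfunctor \<Rightarrow> ('p, 'b, 'r, 'd) cfunctor \<Rightarrow>
   ('p \<Rightarrow> 'c) \<Rightarrow> ('o \<Rightarrow> 'd) \<Rightarrow> bool" where
  "mate_pair S T U V \<zeta> \<xi> \<longleftrightarrow>
     nat_trans (RCat S) (LCat T) (comp_functor U (RAdj S)) (comp_functor (RAdj T) V) \<zeta> \<and>
     nat_trans (LCat S) (RCat T) (comp_functor (LAdj T) U) (comp_functor V (LAdj S)) \<xi> \<and>
     (\<forall>a \<in> Obj (LCat S).
        \<xi> a = Comp (RCat T) (Counit T (FObj V (FObj (LAdj S) a)))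
               (Comp (RCat T) (FArr (LAdj T) (\<zeta> (FObj (LAdj S) a)))
                 (FArr (LAdj T) (FArr U (Unit S a)))))"

definition right_adjunction_morphism ::
  "('o, 'a, 'p, 'b) adj \<Rightarrow> ('q, 'c, 'r, 'd) adj \<Rightarrow>
   ('o, 'a, 'q, 'c) cfunctor \<Rightarrow> ('p, 'b, 'r, 'd) cfunctor \<Rightarrow>
   ('p \<Rightarrow> 'c) \<Rightarrow> ('o \<Rightarrow> 'd) \<Rightarrow> bool" where
  "right_adjunction_morphism S T U V \<zeta> \<xi> \<longleftrightarrow>
     adjunction S \<and> adjunction T \<and>
     is_functor (LCat S) (LCat T) U \<and> is_functor (RCat S) (RCat T) V \<and>
     mate_pair S T U V \<zeta> \<xi> \<and>
     (\<forall>b \<in> Obj (RCat S). iso_arr (LCat T) (\<zeta> b))"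


section \<open>The categories of sets, topological spaces and frames\<close>

text \<open>An arrow of a concrete category carries its source, its target and an underlying function,
  which is normalised to \<open>undefined\<close> outside the carrier of the source.\<close>

datatype ('s, 'x) cmor = CMor (csrc: 's) (ctgt: 's) (cfun: "'x \<Rightarrow> 'x")

definition concrete_cat ::
  "'s set \<Rightarrow> ('s \<Rightarrow> 'x set) \<Rightarrow> ('s \<Rightarrow> 's \<Rightarrow> ('x \<Rightarrow> 'x) \<Rightarrow> bool) \<Rightarrow> ('s, ('s, 'x) cmor) cat" where
  "concrete_cat Ob car P =
     \<lparr>Obj = Ob,
      Arr = {CMor X Y f | X Y f. X \<in> Ob \<and> Y \<in> Ob \<and> f \<in> extensional (car X) \<and> P X Y f},
      Dom = csrc, Cod = ctgt,
      Ide = (\<lambda>X. CMor X X (\<lambda>x \<in> car X. x)),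
      Comp = (\<lambda>g f. CMor (csrc f) (ctgt g) (compose (car (csrc f)) (cfun g) (cfun f)))\<rparr>"

definition Set_cat :: "('x set, ('x set, 'x) cmor) cat" where
  "Set_cat = concrete_cat UNIV (\<lambda>X. X) (\<lambda>X Y f. f \<in> X \<rightarrow> Y)"

definition Top_cat :: "('x topology, ('x topology, 'x) cmor) cat" where
  "Top_cat = concrete_cat UNIV topspace continuous_map"

locale frame = complete_lattice L for L :: "'f gorder" (structure) +
  assumes inf_sup_distrib: "\<lbrakk>a \<in> carrier L; S \<subseteq> carrier L\<rbrakk> \<Longrightarrow> a \<sqinter> \<Squnion>S = \<Squnion>((\<lambda>s. a \<sqinter> s) ` S)"

definition frame_hom :: "'f gorder \<Rightarrow> 'g gorder \<Rightarrow> ('f \<Rightarrow> 'g) \<Rightarrow> bool" where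
  "frame_hom L M h \<longleftrightarrow> h \<in> carrier L \<rightarrow> carrier M \<and>
     h \<top>\<^bsub>L\<^esub> = \<top>\<^bsub>M\<^esub> \<and>
     (\<forall>a \<in> carrier L. \<forall>b \<in> carrier L. h (a \<sqinter>\<^bsub>L\<^esub> b) = h a \<sqinter>\<^bsub>M\<^esub> h b) \<and>
     (\<forall>S \<subseteq> carrier L. h (\<Squnion>\<^bsub>L\<^esub>S) = \<Squnion>\<^bsub>M\<^esub>(h ` S))"

definition frame_iso :: "'f gorder \<Rightarrow> 'g gorder \<Rightarrow> ('f \<Rightarrow> 'g) \<Rightarrow> bool" where
  "frame_iso L M h \<longleftrightarrow> frame_hom L M h \<and>
     (\<exists>k. frame_hom M L k \<and> (\<forall>a \<in> carrier L. k (h a) = a) \<and> (\<forall>b \<in> carrier M. h (k b) = b))"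

definition Frm_cat :: "('f gorder, ('f gorder, 'f) cmor) cat" where
  "Frm_cat = concrete_cat {L. frame L} carrier frame_hom"

definition frame_two :: "bool gorder" where
  "frame_two = \<lparr>carrier = UNIV, eq = (=), le = (\<le>)\<rparr>"

text \<open>The Sierpinski space \<open>{0, 1}\<close>, with 1 rendered as \<open>True\<close>.\<close>

definition sierpinski :: "bool topology" where
  "sierpinski = topology (\<lambda>U. U \<in> {{}, {True}, UNIV})"

definition maps_to_sierpinski :: "'x topology \<Rightarrow> ('x \<Rightarrow> bool) set" where
  "maps_to_sierpinski X = {g \<in> extensional (topspace X). continuous_map X sierpinski g}"

definition forget_Frm :: "('f gorder, ('f gorder, 'f) cmor, 'f set, ('f set, 'f) cmor) cfunctor" where
  "forget_Frm = \<lparr>FObj = carrier,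
     FArr = (\<lambda>h. CMor (carrier (csrc h)) (carrier (ctgt h)) (cfun h))\<rparr>"


section \<open>Lifts and cartesian lifts\<close>

definition lifts :: "('o, 'a) cat \<Rightarrow> ('o, 'a, 'p, 'b) cfunctor \<Rightarrow> 'o \<Rightarrow> 'o \<Rightarrow> 'b \<Rightarrow> bool" where
  "lifts A U a a' f \<longleftrightarrow> (\<exists>p \<in> Hom A a a'. FArr U p = f)"

definition lift_of :: "('o, 'a) cat \<Rightarrow> ('o, 'a, 'p, 'b) cfunctor \<Rightarrow> 'o \<Rightarrow> 'o \<Rightarrow> 'b \<Rightarrow> 'a" where
  "lift_of A U a a' f = (THE p. p \<in> Hom A a a' \<and> FArr U p = f)"

text \<open>Cartesian lift, with respect to a set-valued functor \<open>U\<close>, of a family of functions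
  \<open>F i : X \<rightarrow> U c\<close> (\<open>i \<in> I\<close>). The set \<open>X\<close> may have elements of a type other than that of the
  sets \<open>U a\<close>; accordingly \<open>\<theta>\<close>, an isomorphism of sets \<open>U Xbar \<rightarrow> X\<close>, is given as a
  bijection rather than as an arrow of \<open>Set_cat\<close>.\<close>

definition cartesian_lift ::
  "('o, 'a) cat \<Rightarrow> ('o, 'a, 'f set, ('f set, 'f) cmor) cfunctor \<Rightarrow> 'o \<Rightarrow>
   'i set \<Rightarrow> 'x set \<Rightarrow> ('i \<Rightarrow> 'x \<Rightarrow> 'f) \<Rightarrow> 'o \<Rightarrow> ('f \<Rightarrow> 'x) \<Rightarrow> bool" where
  "cartesian_lift A U c I X F Xbar \<theta> \<longleftrightarrow>
     Xbar \<in> Obj A \<and> bij_betw \<theta> (FObj U Xbar) X \<and>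
     (\<forall>d \<in> Obj A. \<forall>h \<in> Hom Set_cat (FObj U d) (FObj U Xbar).
        lifts A U d Xbar h \<longleftrightarrow>
        (\<forall>i \<in> I. lifts A U d c
           (CMor (FObj U d) (FObj U c) (\<lambda>a \<in> FObj U d. F i (\<theta> (cfun h a))))))"


section \<open>PFC-categories and SFC-categories\<close>

text \<open>\<open>'u\<close> is both the type of arrows and the type of points of spaces, so that the hom-sets
  underlying the spaces \<open>pt K c\<close> are sets of points; the object types of two categories may differ.\<close>

record ('o, 'u, 'f) pfc =
  Frames :: "('o, 'u, 'f gorder, ('f gorder, 'f) cmor) cfunctor"
  Cat :: "('o, 'u) cat"
  Two :: 'o
  Iota :: "'f \<Rightarrow> bool"

definition pfc_category :: "('o, 'u, 'f, 'm) pfc_scheme \<Rightarrow> bool" where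
  "pfc_category K \<longleftrightarrow>
     is_functor (Cat K) Frm_cat (Frames K) \<and> faithful (Cat K) (Frames K) \<and>
     Two K \<in> Obj (Cat K) \<and> frame_iso (FObj (Frames K) (Two K)) frame_two (Iota K)"

text \<open>\<open>|O(-)|\<close> as a functor, on objects, and (as bare functions) on arrows.\<close>

definition und :: "('o, 'u, 'f, 'm) pfc_scheme \<Rightarrow> ('o, 'u, 'f set, ('f set, 'f) cmor) cfunctor" where
  "und K = comp_functor forget_Frm (Frames K)"

definition und_set :: "('o, 'u, 'f, 'm) pfc_scheme \<Rightarrow> 'o \<Rightarrow> 'f set" where
  "und_set K c = carrier (FObj (Frames K) c)"

definition und_fun :: "('o, 'u, 'f, 'm) pfc_scheme \<Rightarrow> 'u \<Rightarrow> 'f \<Rightarrow> 'f" where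
  "und_fun K p = cfun (FArr (Frames K) p)"

definition Iota_inv :: "('o, 'u, 'f, 'm) pfc_scheme \<Rightarrow> bool \<Rightarrow> 'f" where
  "Iota_inv K = inv_into (und_set K (Two K)) (Iota K)"

definition chi :: "'x \<Rightarrow> ('x \<Rightarrow> bool) \<Rightarrow> bool" where
  "chi x g = g x"

definition Omega_lift ::
  "('o, 'u, 'f, 'm) pfc_scheme \<Rightarrow> 'x topology \<Rightarrow> 'o \<Rightarrow> ('f \<Rightarrow> 'x \<Rightarrow> bool) \<Rightarrow> bool" where
  "Omega_lift K X Xbar \<theta> \<longleftrightarrow>
     cartesian_lift (Cat K) (und K) (Two K) (topspace X) (maps_to_sierpinski X)
       (\<lambda>x g. Iota_inv K (chi x g)) Xbar \<theta>"

text \<open>Membership in \<open>Top\<^sub>K\<close> is defined for spaces with points in any type, hence makes sense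
  for the Sierpinski space; the category \<open>TopK K\<close> comprises the spaces with points in \<open>'u\<close>.\<close>

definition in_TopK :: "('o, 'u, 'f, 'm) pfc_scheme \<Rightarrow> 'x topology \<Rightarrow> bool" where
  "in_TopK K X \<longleftrightarrow> (\<exists>Xbar \<theta>. Omega_lift K X Xbar \<theta>)"

definition TopK ::
  "('o, 'u, 'f, 'm) pfc_scheme \<Rightarrow> ('u topology, ('u topology, 'u) cmor) cat" where
  "TopK K = full_subcat Top_cat {X. in_TopK K X}"

definition pt :: "('o, 'u, 'f, 'm) pfc_scheme \<Rightarrow> 'o \<Rightarrow> 'u topology" where
  "pt K c = topology (\<lambda>W. \<exists>a \<in> und_set K c.
     W = {f \<in> Hom (Cat K) c (Two K). Iota K (und_fun K f a)})"

text \<open>The chosen cartesian lifts \<open>(\<Omega> X, \<theta>\<^sub>X)\<close> are recorded as data; the choice is arbitrary.\<close>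

record ('o, 'u, 'f) sfc = "('o, 'u, 'f) pfc" +
  Omega :: "'u topology \<Rightarrow> 'o"
  Theta :: "'u topology \<Rightarrow> 'f \<Rightarrow> 'u \<Rightarrow> bool"

definition sfc_category :: "('o, 'u, 'f) sfc \<Rightarrow> bool" where
  "sfc_category K \<longleftrightarrow> pfc_category K \<and> in_TopK K sierpinski \<and>
     (\<forall>c \<in> Obj (Cat K). in_TopK K (pt K c)) \<and>
     (\<forall>X. in_TopK K X \<longrightarrow> Omega_lift K X (Omega K X) (Theta K X))"

definition Theta_inv :: "('o, 'u, 'f) sfc \<Rightarrow> 'u topology \<Rightarrow> ('u \<Rightarrow> bool) \<Rightarrow> 'f" where
  "Theta_inv K X = inv_into (und_set K (Omega K X)) (Theta K X)"

definition chi_bar :: "('o, 'u, 'f) sfc \<Rightarrow> 'u topology \<Rightarrow> 'u \<Rightarrow> 'u" where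
  "chi_bar K X x = lift_of (Cat K) (und K) (Omega K X) (Two K)
     (CMor (und_set K (Omega K X)) (und_set K (Two K))
       (\<lambda>a \<in> und_set K (Omega K X). Iota_inv K (chi x (Theta K X a))))"

definition pt_functor ::
  "('o, 'u, 'f) sfc \<Rightarrow> ('o, 'u, 'u topology, ('u topology, 'u) cmor) cfunctor" where
  "pt_functor K = \<lparr>FObj = pt K,
     FArr = (\<lambda>p. CMor (pt K (Cod (Cat K) p)) (pt K (Dom (Cat K) p))
       (\<lambda>f \<in> Hom (Cat K) (Cod (Cat K) p) (Two K). Comp (Cat K) f p))\<rparr>"

definition Omega_functor ::
  "('o, 'u, 'f) sfc \<Rightarrow> ('u topology, ('u topology, 'u) cmor, 'o, 'u) cfunctor" where
  "Omega_functor K = \<lparr>FObj = Omega K,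
     FArr = (\<lambda>m. lift_of (Cat K) (und K) (Omega K (ctgt m)) (Omega K (csrc m))
       (CMor (und_set K (Omega K (ctgt m))) (und_set K (Omega K (csrc m)))
         (\<lambda>a \<in> und_set K (Omega K (ctgt m)).
            Theta_inv K (csrc m)
              (compose (topspace (csrc m)) (Theta K (ctgt m) a) (cfun m)))))\<rparr>"

definition eta :: "('o, 'u, 'f) sfc \<Rightarrow> 'o \<Rightarrow> 'u" where
  "eta K c = (THE p. p \<in> Hom (Cat K) c (Omega K (pt K c)) \<and>
     (\<forall>a \<in> und_set K c. Theta K (pt K c) (und_fun K p a) =
        (\<lambda>f \<in> Hom (Cat K) c (Two K). Iota K (und_fun K f a))))"

definition sigma :: "('o, 'u, 'f) sfc \<Rightarrow> 'u topology \<Rightarrow> ('u topology, 'u) cmor" where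
  "sigma K X = CMor X (pt K (Omega K X)) (\<lambda>x \<in> topspace X. chi_bar K X x)"

text \<open>The map \<open>sigma K X : X \<rightarrow> pt (\<Omega> X)\<close> is an arrow \<open>pt (\<Omega> X) \<rightarrow> X\<close> of the opposite category,
  where it is the counit.\<close>

definition pt_Omega ::
  "('o, 'u, 'f) sfc \<Rightarrow> ('o, 'u, 'u topology, ('u topology, 'u) cmor) adj" where
  "pt_Omega K = \<lparr>LCat = Cat K, RCat = op_cat (TopK K),
     LAdj = pt_functor K, RAdj = Omega_functor K, Unit = eta K, Counit = sigma K\<rparr>"


section \<open>PFC-functors and SFC-functors\<close>

definition pfc_functor ::
  "('o, 'u, 'f, 'm) pfc_scheme \<Rightarrow> ('p, 'u, 'f, 'n) pfc_scheme \<Rightarrow>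
   ('o, 'u, 'p, 'u) cfunctor \<Rightarrow> ('o \<Rightarrow> ('f gorder, 'f) cmor) \<Rightarrow> 'u \<Rightarrow> bool" where
  "pfc_functor C D H \<alpha> i \<longleftrightarrow>
     is_functor (Cat C) (Cat D) H \<and>
     nat_iso (Cat C) Frm_cat (comp_functor (Frames D) H) (Frames C) \<alpha> \<and>
     i \<in> Hom (Cat D) (FObj H (Two C)) (Two D) \<and> iso_arr (Cat D) i \<and>
     (\<forall>a \<in> und_set D (FObj H (Two C)).
        Iota D (und_fun D i a) = Iota C (cfun (\<alpha> (Two C)) a))"

definition sfc_functor ::
  "('o, 'u, 'f) sfc \<Rightarrow> ('p, 'u, 'f) sfc \<Rightarrow>
   ('o, 'u, 'p, 'u) cfunctor \<Rightarrow> ('o \<Rightarrow> ('f gorder, 'f) cmor) \<Rightarrow> 'u \<Rightarrow> bool" where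
  "sfc_functor C D H \<alpha> i \<longleftrightarrow>
     sfc_category C \<and> sfc_category D \<and> pfc_functor C D H \<alpha> i \<and>
     (\<forall>X \<in> Obj (TopK C).
        cartesian_lift (Cat D) (und D) (FObj H (Two C)) (topspace X) (maps_to_sierpinski X)
          (\<lambda>x g. inv_into (und_set D (FObj H (Two C))) (cfun (\<alpha> (Two C))) (Iota_inv C (chi x g)))
          (FObj H (Omega C X)) (\<lambda>a. Theta C X (cfun (\<alpha> (Omega C X)) a)))"

definition zeta_fun ::
  "('o, 'u, 'f) sfc \<Rightarrow> ('p, 'u, 'f) sfc \<Rightarrow>
   ('o, 'u, 'p, 'u) cfunctor \<Rightarrow> ('o \<Rightarrow> ('f gorder, 'f) cmor) \<Rightarrow>
   'u topology \<Rightarrow> ('f set, 'f) cmor" where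
  "zeta_fun C D H \<alpha> X =
     CMor (und_set D (FObj H (Omega C X))) (und_set D (Omega D X))
       (\<lambda>a \<in> und_set D (FObj H (Omega C X)).
          Theta_inv D X (Theta C X (cfun (\<alpha> (Omega C X)) a)))"

definition zeta ::
  "('o, 'u, 'f) sfc \<Rightarrow> ('p, 'u, 'f) sfc \<Rightarrow>
   ('o, 'u, 'p, 'u) cfunctor \<Rightarrow> ('o \<Rightarrow> ('f gorder, 'f) cmor) \<Rightarrow> 'u topology \<Rightarrow> 'u" where
  "zeta C D H \<alpha> X = lift_of (Cat D) (und D) (FObj H (Omega C X)) (Omega D X) (zeta_fun C D H \<alpha> X)"

definition xi ::
  "('o, 'u, 'f) sfc \<Rightarrow> ('p, 'u, 'f) sfc \<Rightarrow>
   ('o, 'u, 'p, 'u) cfunctor \<Rightarrow> 'u \<Rightarrow> 'o \<Rightarrow> ('u topology, 'u) cmor" where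
  "xi C D H i c = CMor (pt C c) (pt D (FObj H c))
     (\<lambda>f \<in> Hom (Cat C) c (Two C). Comp (Cat D) i (FArr H f))"

end

theory Submission
  imports Defs
begin

text \<open>Every equation between arrows is checked on underlying functions. Three uniqueness principles
  make this possible: an arrow of a PFC-category is determined by its underlying function
  (faithfulness, \<open>arr_eqI\<close>); an arrow \<open>p\<close> into \<open>\<Omega> X\<close> is determined by the functions \<open>\<theta> (p a)\<close> on
  \<open>X\<close>, because \<open>\<theta>\<close> is injective (\<open>Omega_eqI\<close>); and a point \<open>p : c \<rightarrow> 2\<close> is determined by the truth
  values \<open>\<iota> (p a)\<close> (\<open>point_eqI\<close>). Existence of arrows comes from the cartesian lifts: a function \<open>h\<close>
  into \<open>|O (\<Omega> X)|\<close> lifts iff, for each point \<open>x\<close> of \<open>X\<close>, the predicate \<open>a \<mapsto> \<theta> (h a) x\<close> is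
  given by a point (\<open>Omega_lift_iff\<close>).

  In these terms \<open>\<Omega>\<close>, \<open>\<eta>\<close> and \<open>\<sigma>\<close> obey \<open>\<theta> (\<Omega> m b) = \<theta> b \<circ> m\<close>, \<open>\<theta> (\<eta> a) f = \<iota> (f a)\<close> and
  \<open>\<iota> (\<sigma> x a) = \<theta> a x\<close> (\<open>Theta_Omega_map\<close>, \<open>Theta_eta\<close>, \<open>Iota_chi_bar\<close>), from which functoriality,
  naturality and the triangle identities follow by substitution (\<open>adjunction_pt_Omega\<close>).

  Let now \<open>H\<close> be an SFC-functor. By \<open>i\<close>, arrows \<open>d \<rightarrow> H 2\<close> correspond to points of \<open>d\<close>
  (\<open>tracked_H_Two_iff\<close>), so the preserved cartesian lift \<open>(H \<Omega>\<^sub>C X, \<theta>\<^sub>C \<circ> \<alpha>)\<close> is a cartesian lift of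
  the very family that \<open>\<Omega>\<^sub>D X\<close> lifts (\<open>Omega_lift_H\<close>). Hence \<open>Top\<^sub>C\<close> is contained in \<open>Top\<^sub>D\<close>, and
  the comparison \<open>\<zeta>\<close> of these two lifts, characterised by \<open>\<theta>\<^sub>D (\<zeta> a) = \<theta>\<^sub>C (\<alpha> a)\<close>, exists and is
  invertible (\<open>Theta_zeta\<close>, \<open>iso_zeta\<close>). Since \<open>\<iota>\<^sub>D ((i \<circ> H f) b) = \<iota>\<^sub>C (f (\<alpha> b))\<close>
  (\<open>Iota_H_point\<close>), the map \<open>\<xi>\<close> is continuous; and the mate of \<open>\<zeta>\<close> sends \<open>f\<close> to the point with
  value \<open>\<theta>\<^sub>D (\<zeta> (H \<eta> b)) f = \<theta>\<^sub>C (\<alpha> (H \<eta> b)) f = \<theta>\<^sub>C (\<eta> (\<alpha> b)) f = \<iota>\<^sub>C (f (\<alpha> b))\<close> at \<open>b\<close>,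
  which is \<open>\<xi> f\<close> (\<open>xi_mate_zeta\<close>).\<close>

section \<open>Opposite categories, identity and composite functors\<close>

lemma HomD:
  assumes "f \<in> Hom C a b"
  shows "f \<in> Arr C" "Dom C f = a" "Cod C f = b"
  using assms by (auto simp: Hom_def)

lemma op_cat_simps [simp]:
  "Obj (op_cat C) = Obj C" "Arr (op_cat C) = Arr C" "Dom (op_cat C) = Cod C"
  "Cod (op_cat C) = Dom C" "Ide (op_cat C) = Ide C" "Comp (op_cat C) g f = Comp C f g"
  "Hom (op_cat C) a b = Hom C b a"
  by (auto simp: op_cat_def Hom_def)

lemma category_op_cat:
  assumes "category C"
  shows "category (op_cat C)"
proof -
  interpret category C by fact
  show ?thesis
    by unfold_locales (auto intro: dom_obj cod_obj ide_hom comp_hom comp_ide_left comp_ide_right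
        comp_assoc [symmetric])
qed

lemma (in category) Hom_obj:
  assumes "f \<in> Hom C a b"
  shows "a \<in> Obj C" "b \<in> Obj C"
  using assms dom_obj cod_obj by (auto simp: Hom_def)

lemma id_functor_simps [simp]: "FObj id_functor a = a" "FArr id_functor f = f"
  by (auto simp: id_functor_def)

lemma comp_functor_simps [simp]:
  "FObj (comp_functor G F) a = FObj G (FObj F a)"
  "FArr (comp_functor G F) f = FArr G (FArr F f)"
  by (auto simp: comp_functor_def)

lemma is_functor_id:
  assumes "category C"
  shows "is_functor C C id_functor"
proof -
  interpret category C by fact
  show ?thesis by unfold_locales auto
qed

lemma is_functor_comp:
  assumes "is_functor A B F" "is_functor B C G"
  shows "is_functor A C (comp_functor G F)"
proof -
  interpret F: is_functor A B F by fact
  interpret G: is_functor B C G by fact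
  show ?thesis
    by unfold_locales
      (auto intro: F.map_obj G.map_obj F.map_hom G.map_hom
        simp: F.map_ide G.map_ide [OF F.map_obj] F.map_comp G.map_comp [OF F.map_hom F.map_hom])
qed


section \<open>Topological spaces, the Sierpinski space and the two-element frame\<close>

lemma openin_sierpinski: "openin sierpinski U \<longleftrightarrow> U \<in> {{}, {True}, UNIV}"
proof -
  have "istopology (\<lambda>U. U \<in> {{}, {True}, UNIV :: bool set})"
    unfolding istopology_def
  proof (intro conjI allI impI)
    fix \<K> :: "bool set set"
    assume "\<forall>K\<in>\<K>. K \<in> {{}, {True}, UNIV}"
    then have "\<Union>\<K> = UNIV \<or> \<Union>\<K> \<subseteq> {True}" by blast
    then show "\<Union>\<K> \<in> {{}, {True}, UNIV}" by blast
  qed auto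
  then show ?thesis unfolding sierpinski_def by (simp add: topology_inverse')
qed

lemma continuous_map_sierpinski_iff:
  "continuous_map X sierpinski g \<longleftrightarrow> openin X {x \<in> topspace X. g x}"
proof -
  have ts: "topspace sierpinski = UNIV"
    unfolding topspace_def openin_sierpinski by blast
  have "(\<forall>U. U \<in> {{}, {True}, UNIV} \<longrightarrow> openin X {x \<in> topspace X. g x \<in> U}) \<longleftrightarrow>
      openin X {x \<in> topspace X. g x}"
    by simp
  then show ?thesis
    unfolding continuous_map_def ts openin_sierpinski by simp
qed

lemma maps_to_sierpinski_iff:
  "g \<in> maps_to_sierpinski X \<longleftrightarrow>
     g \<in> extensional (topspace X) \<and> openin X {x \<in> topspace X. g x}"
  by (simp add: maps_to_sierpinski_def continuous_map_sierpinski_iff)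

lemma frame_two_simps: "carrier frame_two = UNIV" "le frame_two = (\<le>)"
  by (auto simp: frame_two_def)

lemma sup_frame_two: "\<Squnion>\<^bsub>frame_two\<^esub>A \<longleftrightarrow> True \<in> A"
proof -
  have "least frame_two x (Upper frame_two A) \<longleftrightarrow> x = (True \<in> A)" for x
    unfolding least_def Upper_def frame_two_simps by (simp add: Ball_def) (metis (full_types))
  then show ?thesis by (simp add: sup_def)
qed

lemma inf_frame_two: "\<Sqinter>\<^bsub>frame_two\<^esub>A \<longleftrightarrow> False \<notin> A"
proof -
  have "greatest frame_two x (Lower frame_two A) \<longleftrightarrow> x = (False \<notin> A)" for x
    unfolding greatest_def Lower_def frame_two_simps by (simp add: Ball_def) (metis (full_types))
  then show ?thesis by (simp add: inf_def)
qed

lemma meet_frame_two: "a \<sqinter>\<^bsub>frame_two\<^esub> b \<longleftrightarrow> a \<and> b"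
  by (auto simp: meet_def inf_frame_two)

lemma top_frame_two: "\<top>\<^bsub>frame_two\<^esub>"
  unfolding top_def
  by (rule someI2 [where a = True]) (auto simp: greatest_def frame_two_simps)


section \<open>Arrows between frames and between spaces\<close>

lemma concrete_cat_Hom_iff:
  "m \<in> Hom (concrete_cat Ob car P) X Y \<longleftrightarrow>
     X \<in> Ob \<and> Y \<in> Ob \<and> csrc m = X \<and> ctgt m = Y \<and> cfun m \<in> extensional (car X) \<and> P X Y (cfun m)"
  by (cases m) (auto simp: Hom_def concrete_cat_def)

lemma Set_cat_Hom_iff:
  "m \<in> Hom Set_cat X Y \<longleftrightarrow>
     csrc m = X \<and> ctgt m = Y \<and> cfun m \<in> extensional X \<and> cfun m \<in> X \<rightarrow> Y"
  by (simp add: Set_cat_def concrete_cat_Hom_iff)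

lemma Frm_cat_Hom_iff:
  "m \<in> Hom Frm_cat L M \<longleftrightarrow> frame L \<and> frame M \<and>
     csrc m = L \<and> ctgt m = M \<and> cfun m \<in> extensional (carrier L) \<and> frame_hom L M (cfun m)"
  by (simp add: Frm_cat_def concrete_cat_Hom_iff)

lemma TopK_simps [simp]:
  "Obj (TopK K) = {X. in_TopK K X}"
  "Ide (TopK K) X = CMor X X (\<lambda>x \<in> topspace X. x)"
  "Comp (TopK K) g f = CMor (csrc f) (ctgt g) (compose (topspace (csrc f)) (cfun g) (cfun f))"
  "Dom (TopK K) = csrc" "Cod (TopK K) = ctgt"
  by (auto simp: TopK_def full_subcat_def Top_cat_def concrete_cat_def)

lemma TopK_Hom_iff:
  "m \<in> Hom (TopK K) X Y \<longleftrightarrow> in_TopK K X \<and> in_TopK K Y \<and>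
     csrc m = X \<and> ctgt m = Y \<and> cfun m \<in> extensional (topspace X) \<and> continuous_map X Y (cfun m)"
  by (cases m) (auto simp: TopK_def full_subcat_def Top_cat_def concrete_cat_def Hom_def)

lemma TopK_eqI:
  assumes "m \<in> Hom (TopK K) X Y" "n \<in> Hom (TopK K) X Y"
    and "\<And>x. x \<in> topspace X \<Longrightarrow> cfun m x = cfun n x"
  shows "m = n"
  using assms by (cases m; cases n) (auto simp: TopK_Hom_iff intro: extensionalityI)

lemma Hom_TopK_in: "\<lbrakk>m \<in> Hom (TopK K) X Y; x \<in> topspace X\<rbrakk> \<Longrightarrow> cfun m x \<in> topspace Y"
  by (auto simp: TopK_Hom_iff dest: continuous_map_funspace)

lemma cfun_Comp_TopK:
  "\<lbrakk>m \<in> Hom (TopK K) X Y; x \<in> topspace X\<rbrakk> \<Longrightarrow> cfun (Comp (TopK K) n m) x = cfun n (cfun m x)"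
  by (simp add: TopK_Hom_iff compose_eq)

lemma continuous_map_compose_on:
  assumes "continuous_map X Y f" "continuous_map Y Z g"
  shows "continuous_map X Z (compose (topspace X) g f)"
  by (rule continuous_map_eq [OF continuous_map_compose [OF assms]]) (simp add: compose_eq)

lemma category_TopK:
  fixes K :: "('o, 'u, 'f, 'm) pfc_scheme"
  shows "category (TopK K)"
proof
  fix f :: "('u topology, 'u) cmor"
  assume "f \<in> Arr (TopK K)"
  then show "Dom (TopK K) f \<in> Obj (TopK K)" "Cod (TopK K) f \<in> Obj (TopK K)"
    by (auto simp: TopK_def full_subcat_def Top_cat_def concrete_cat_def)
next
  fix X :: "'u topology"
  assume "X \<in> Obj (TopK K)"
  then show "Ide (TopK K) X \<in> Hom (TopK K) X X"
    using continuous_map_eq [OF continuous_map_id [of X], of "\<lambda>x \<in> topspace X. x"]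
    by (simp add: TopK_Hom_iff)
next
  fix f g :: "('u topology, 'u) cmor" and X Y Z
  assume "f \<in> Hom (TopK K) X Y" "g \<in> Hom (TopK K) Y Z"
  then show "Comp (TopK K) g f \<in> Hom (TopK K) X Z"
    by (auto simp: TopK_Hom_iff intro: continuous_map_compose_on)
next
  fix f :: "('u topology, 'u) cmor" and X Y
  assume f: "f \<in> Hom (TopK K) X Y"
  then have "cfun f \<in> topspace X \<rightarrow> topspace Y"
    by (simp add: TopK_Hom_iff continuous_map_funspace)
  then show "Comp (TopK K) f (Ide (TopK K) X) = f" "Comp (TopK K) (Ide (TopK K) Y) f = f"
    using f by (cases f; auto simp: TopK_Hom_iff compose_Id Id_compose)+
next
  fix f g h :: "('u topology, 'u) cmor" and X Y Z W
  assume fgh: "f \<in> Hom (TopK K) X Y" "g \<in> Hom (TopK K) Y Z" "h \<in> Hom (TopK K) Z W"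
  then have "cfun f \<in> topspace X \<rightarrow> topspace Y"
    by (simp add: TopK_Hom_iff continuous_map_funspace)
  then show "Comp (TopK K) h (Comp (TopK K) g f) = Comp (TopK K) (Comp (TopK K) h g) f"
    using fgh by (auto simp: TopK_Hom_iff compose_assoc)
qed


section \<open>Arrows of a PFC-category as functions\<close>

locale pfc_cat =
  fixes K :: "('o, 'u, 'f, 'm) pfc_scheme"
  assumes pfc: "pfc_category K"
begin

sublocale frames: is_functor "Cat K" Frm_cat "Frames K"
  using pfc by (simp add: pfc_category_def)

lemma Two_obj: "Two K \<in> Obj (Cat K)"
  using pfc by (simp add: pfc_category_def)

lemma Frames_Hom:
  assumes "p \<in> Hom (Cat K) c d"
  shows "FArr (Frames K) p = CMor (FObj (Frames K) c) (FObj (Frames K) d) (und_fun K p)"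
    and "und_fun K p \<in> extensional (und_set K c)"
    and "frame_hom (FObj (Frames K) c) (FObj (Frames K) d) (und_fun K p)"
  using frames.map_hom [OF assms] by (auto simp: Frm_cat_Hom_iff und_fun_def und_set_def cmor.expand)

lemma frame_Frames: "c \<in> Obj (Cat K) \<Longrightarrow> frame (FObj (Frames K) c)"
  using frames.map_obj [of c] by (simp add: Frm_cat_def concrete_cat_def)

lemma und_simps:
  "FObj (und K) c = und_set K c"
  "p \<in> Hom (Cat K) c d \<Longrightarrow> FArr (und K) p = CMor (und_set K c) (und_set K d) (und_fun K p)"
  by (simp_all add: und_def forget_Frm_def und_set_def Frames_Hom)

lemma und_fun_in:
  assumes "p \<in> Hom (Cat K) c d" "a \<in> und_set K c"
  shows "und_fun K p a \<in> und_set K d"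
  using Frames_Hom(3) [OF assms(1)] assms(2) by (auto simp: frame_hom_def und_set_def)

lemma und_fun_Comp:
  assumes "p \<in> Hom (Cat K) c d" "q \<in> Hom (Cat K) d e" "a \<in> und_set K c"
  shows "und_fun K (Comp (Cat K) q p) a = und_fun K q (und_fun K p a)"
proof -
  have "FArr (Frames K) (Comp (Cat K) q p) = Comp Frm_cat (FArr (Frames K) q) (FArr (Frames K) p)"
    by (rule frames.map_comp [OF assms(1,2)])
  then have "cfun (FArr (Frames K) (Comp (Cat K) q p)) a = und_fun K q (und_fun K p a)"
    using assms(3) by (simp add: Frames_Hom(1) [OF assms(1)] Frames_Hom(1) [OF assms(2)]
        Frm_cat_def concrete_cat_def und_set_def compose_eq)
  then show ?thesis by (simp add: und_fun_def [of K "Comp (Cat K) q p"])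
qed

lemma und_fun_Ide:
  assumes "c \<in> Obj (Cat K)" "a \<in> und_set K c"
  shows "und_fun K (Ide (Cat K) c) a = a"
  using assms by (simp add: und_fun_def frames.map_ide Frm_cat_def concrete_cat_def und_set_def)

text \<open>Faithfulness: an arrow is determined by its underlying function.\<close>

lemma arr_eqI:
  assumes p: "p \<in> Hom (Cat K) c d" and q: "q \<in> Hom (Cat K) c d"
    and eq: "\<And>a. a \<in> und_set K c \<Longrightarrow> und_fun K p a = und_fun K q a"
  shows "p = q"
proof -
  have "c \<in> Obj (Cat K)" "d \<in> Obj (Cat K)"
    using frames.source.Hom_obj [OF p] by auto
  then have inj: "inj_on (FArr (Frames K)) (Hom (Cat K) c d)"
    using pfc by (simp add: pfc_category_def faithful_def)
  have "und_fun K p = und_fun K q"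
    by (rule extensionalityI [OF Frames_Hom(2) [OF p] Frames_Hom(2) [OF q] eq])
  then have "FArr (Frames K) p = FArr (Frames K) q"
    by (simp add: Frames_Hom(1) [OF p] Frames_Hom(1) [OF q])
  then show ?thesis using inj p q by (simp add: inj_on_def)
qed

lemma iso_arr_und_fun:
  assumes p: "p \<in> Hom (Cat K) c d" and q: "q \<in> Hom (Cat K) d c"
    and "\<And>a. a \<in> und_set K c \<Longrightarrow> und_fun K q (und_fun K p a) = a"
    and "\<And>b. b \<in> und_set K d \<Longrightarrow> und_fun K p (und_fun K q b) = b"
  shows "iso_arr (Cat K) p"
proof -
  note obj = frames.source.Hom_obj [OF p]
  have "Comp (Cat K) q p = Ide (Cat K) c"
    by (rule arr_eqI [where c = c and d = c])
      (use obj assms in \<open>auto intro: frames.source.comp_hom frames.source.ide_hom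
        simp: und_fun_Comp [OF p q] und_fun_Ide\<close>)
  moreover have "Comp (Cat K) p q = Ide (Cat K) d"
    by (rule arr_eqI [where c = d and d = d])
      (use obj assms in \<open>auto intro: frames.source.comp_hom frames.source.ide_hom
        simp: und_fun_Comp [OF q p] und_fun_Ide\<close>)
  ultimately show ?thesis
    using p q unfolding iso_arr_def by (auto simp: HomD)
qed

end

text \<open>\<open>tracked K c d k\<close>: the restriction of \<open>k\<close> to \<open>|O c|\<close> is the underlying function of an arrow
  \<open>c \<rightarrow> d\<close>. This is liftability freed from the normalisation of functions outside their domain;
  the values of \<open>k\<close> outside \<open>|O c|\<close> are irrelevant.\<close>

definition tracked :: "('o, 'u, 'f, 'm) pfc_scheme \<Rightarrow> 'o \<Rightarrow> 'o \<Rightarrow> ('f \<Rightarrow> 'f) \<Rightarrow> bool" where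
  "tracked K c d k \<longleftrightarrow> (\<exists>p \<in> Hom (Cat K) c d. \<forall>a \<in> und_set K c. und_fun K p a = k a)"

text \<open>\<open>is_point K c u\<close>: on \<open>|O c|\<close>, the predicate \<open>u\<close> is \<open>\<iota>\<close> composed with the underlying function
  of an arrow \<open>c \<rightarrow> 2\<close>.\<close>

definition is_point :: "('o, 'u, 'f, 'm) pfc_scheme \<Rightarrow> 'o \<Rightarrow> ('f \<Rightarrow> bool) \<Rightarrow> bool" where
  "is_point K c u \<longleftrightarrow>
     (\<exists>p \<in> Hom (Cat K) c (Two K). \<forall>a \<in> und_set K c. Iota K (und_fun K p a) = u a)"

lemma is_point_cong:
  assumes "\<And>a. a \<in> und_set K c \<Longrightarrow> u a = v a"
  shows "is_point K c u \<longleftrightarrow> is_point K c v"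
  using assms by (simp add: is_point_def)

context pfc_cat
begin

lemma und_eq_iff:
  assumes "p \<in> Hom (Cat K) c d"
  shows "FArr (und K) p = CMor (und_set K c) (und_set K d) (\<lambda>a \<in> und_set K c. k a) \<longleftrightarrow>
     (\<forall>a \<in> und_set K c. und_fun K p a = k a)"
  using Frames_Hom(2) [OF assms] by (auto simp: und_simps(2) [OF assms] fun_eq_iff extensional_def)

lemma lifts_iff_tracked:
  "lifts (Cat K) (und K) c d (CMor (und_set K c) (und_set K d) (\<lambda>a \<in> und_set K c. k a))
     \<longleftrightarrow> tracked K c d k"
  by (auto simp: lifts_def tracked_def und_eq_iff)

text \<open>By faithfulness the lift is unique, so the definite description in \<open>lift_of\<close> denotes it.\<close>

lemma lift_of_tracked:
  assumes "tracked K c d k"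
  defines "p \<equiv> lift_of (Cat K) (und K) c d (CMor (und_set K c) (und_set K d) (\<lambda>a \<in> und_set K c. k a))"
  shows "p \<in> Hom (Cat K) c d" and "\<And>a. a \<in> und_set K c \<Longrightarrow> und_fun K p a = k a"
proof -
  obtain q where q: "q \<in> Hom (Cat K) c d" "\<forall>a \<in> und_set K c. und_fun K q a = k a"
    using assms(1) by (auto simp: tracked_def)
  have "p = q"
    unfolding p_def lift_of_def
    by (rule the_equality) (use q in \<open>auto simp: und_eq_iff intro: arr_eqI\<close>)
  then show "p \<in> Hom (Cat K) c d" and "\<And>a. a \<in> und_set K c \<Longrightarrow> und_fun K p a = k a"
    using q by auto
qed

lemma cartesian_lift_iff_tracked:
  "cartesian_lift (Cat K) (und K) c I X F Z \<theta> \<longleftrightarrow>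
     Z \<in> Obj (Cat K) \<and> bij_betw \<theta> (und_set K Z) X \<and>
     (\<forall>d \<in> Obj (Cat K). \<forall>h \<in> und_set K d \<rightarrow> und_set K Z.
        tracked K d Z h \<longleftrightarrow> (\<forall>i \<in> I. tracked K d c (\<lambda>a. F i (\<theta> (h a)))))"
  (is "?L \<longleftrightarrow> ?A \<and> ?B \<and> ?R")
proof -
  have eq: "(\<forall>h \<in> Hom Set_cat (und_set K d) (und_set K Z).
        lifts (Cat K) (und K) d Z h \<longleftrightarrow>
        (\<forall>i \<in> I. lifts (Cat K) (und K) d c
           (CMor (und_set K d) (und_set K c) (\<lambda>a \<in> und_set K d. F i (\<theta> (cfun h a)))))) \<longleftrightarrow>
     (\<forall>h \<in> und_set K d \<rightarrow> und_set K Z.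
        tracked K d Z h \<longleftrightarrow> (\<forall>i \<in> I. tracked K d c (\<lambda>a. F i (\<theta> (h a)))))" (is "?P \<longleftrightarrow> ?Q") for d
  proof
    assume P: ?P
    show ?Q
    proof
      fix h assume "h \<in> und_set K d \<rightarrow> und_set K Z"
      then have "CMor (und_set K d) (und_set K Z) (restrict h (und_set K d))
          \<in> Hom Set_cat (und_set K d) (und_set K Z)"
        by (auto simp: Set_cat_Hom_iff)
      from P [rule_format, OF this]
      show "tracked K d Z h \<longleftrightarrow> (\<forall>i \<in> I. tracked K d c (\<lambda>a. F i (\<theta> (h a))))"
        by (simp add: lifts_iff_tracked) (simp add: tracked_def)
    qed
  next
    assume Q: ?Q
    show ?P
    proof
      fix h assume h: "h \<in> Hom Set_cat (und_set K d) (und_set K Z)"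
      then have h': "h = CMor (und_set K d) (und_set K Z) (\<lambda>a \<in> und_set K d. cfun h a)"
        by (cases h) (auto simp: Set_cat_Hom_iff extensional_restrict)
      have "cfun h \<in> und_set K d \<rightarrow> und_set K Z"
        using h by (simp add: Set_cat_Hom_iff)
      with Q show "lifts (Cat K) (und K) d Z h \<longleftrightarrow>
        (\<forall>i \<in> I. lifts (Cat K) (und K) d c
           (CMor (und_set K d) (und_set K c) (\<lambda>a \<in> und_set K d. F i (\<theta> (cfun h a)))))"
        by (subst h') (simp add: lifts_iff_tracked)
    qed
  qed
  show ?thesis
    unfolding cartesian_lift_def und_simps(1) eq by blast
qed

lemma Iota_hom: "frame_hom (FObj (Frames K) (Two K)) frame_two (Iota K)"
  using pfc by (simp add: pfc_category_def frame_iso_def)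

lemma bij_Iota: "bij_betw (Iota K) (und_set K (Two K)) UNIV"
proof -
  obtain k where k: "frame_hom frame_two (FObj (Frames K) (Two K)) k"
      "\<forall>a \<in> und_set K (Two K). k (Iota K a) = a" "\<forall>b. Iota K (k b) = b"
    using pfc by (auto simp: pfc_category_def frame_iso_def und_set_def frame_two_simps)
  then show ?thesis
    by (intro bij_betw_byWitness [where f' = k])
      (auto simp: frame_hom_def frame_two_simps und_set_def)
qed

lemma Iota_Iota_inv: "Iota K (Iota_inv K b) = b"
  unfolding Iota_inv_def by (rule bij_betw_inv_into_right [OF bij_Iota]) simp

lemma Iota_inv_eq_iff:
  assumes "a \<in> und_set K (Two K)"
  shows "a = Iota_inv K b \<longleftrightarrow> Iota K a = b"
proof
  show "Iota K a = b" if "a = Iota_inv K b"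
    using that Iota_Iota_inv by simp
  show "a = Iota_inv K b" if "Iota K a = b"
    using bij_betw_inv_into_left [OF bij_Iota assms] that by (simp add: Iota_inv_def)
qed

lemma tracked_Iota_inv_iff: "tracked K c (Two K) (\<lambda>a. Iota_inv K (u a)) \<longleftrightarrow> is_point K c u"
  unfolding tracked_def is_point_def
  by (intro bex_cong ball_cong refl) (simp add: Iota_inv_eq_iff und_fun_in)

lemma point_eqI:
  assumes p: "p \<in> Hom (Cat K) c (Two K)" and q: "q \<in> Hom (Cat K) c (Two K)"
    and eq: "\<And>a. a \<in> und_set K c \<Longrightarrow> Iota K (und_fun K p a) = Iota K (und_fun K q a)"
  shows "p = q"
proof (rule arr_eqI [OF p q])
  fix a assume a: "a \<in> und_set K c"
  show "und_fun K p a = und_fun K q a"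
    using bij_betw_imp_inj_on [OF bij_Iota] und_fun_in [OF p a] und_fun_in [OF q a] eq [OF a]
    by (simp add: inj_on_def)
qed

text \<open>The form in which the universal property of \<open>\<Omega> X\<close> is used: a function lifts iff its
  composite with the evaluation at each point of \<open>X\<close> is given by an arrow to \<open>2\<close>.\<close>

lemma Omega_lift_iff:
  "Omega_lift K X Z \<theta> \<longleftrightarrow>
     Z \<in> Obj (Cat K) \<and> bij_betw \<theta> (und_set K Z) (maps_to_sierpinski X) \<and>
     (\<forall>d \<in> Obj (Cat K). \<forall>h \<in> und_set K d \<rightarrow> und_set K Z.
        tracked K d Z h \<longleftrightarrow> (\<forall>x \<in> topspace X. is_point K d (\<lambda>a. \<theta> (h a) x)))"
  by (simp add: Omega_lift_def cartesian_lift_iff_tracked tracked_Iota_inv_iff chi_def)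


lemma Omega_lift_tracked_iff:
  "\<lbrakk>Omega_lift K X Z \<theta>; d \<in> Obj (Cat K); h \<in> und_set K d \<rightarrow> und_set K Z\<rbrakk> \<Longrightarrow>
    tracked K d Z h \<longleftrightarrow> (\<forall>x \<in> topspace X. is_point K d (\<lambda>a. \<theta> (h a) x))"
  by (simp add: Omega_lift_iff)

text \<open>The identity function of a cartesian lift lifts, so the evaluation at each point of \<open>X\<close> is
  given by an arrow to \<open>2\<close>.\<close>

lemma Omega_lift_is_point:
  assumes Z: "Omega_lift K X Z \<theta>" and x: "x \<in> topspace X"
  shows "is_point K Z (\<lambda>a. \<theta> a x)"
proof -
  have obj: "Z \<in> Obj (Cat K)" using Z by (simp add: Omega_lift_iff)
  have "tracked K Z Z (\<lambda>a. a)"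
    unfolding tracked_def using und_fun_Ide [OF obj] frames.source.ide_hom [OF obj] by blast
  then show ?thesis
    using Omega_lift_tracked_iff [OF Z obj, of "\<lambda>a. a"] x by simp
qed

section \<open>The spaces of points\<close>

lemma point_sup:
  assumes A: "A \<subseteq> und_set K c" and p: "p \<in> Hom (Cat K) c (Two K)"
  shows "Iota K (und_fun K p (\<Squnion>\<^bsub>FObj (Frames K) c\<^esub>A)) \<longleftrightarrow> (\<exists>a \<in> A. Iota K (und_fun K p a))"
proof -
  have "und_fun K p ` A \<subseteq> und_set K (Two K)"
    using und_fun_in [OF p] A by blast
  then have "Iota K (\<Squnion>\<^bsub>FObj (Frames K) (Two K)\<^esub>(und_fun K p ` A)) =
      \<Squnion>\<^bsub>frame_two\<^esub>(Iota K ` und_fun K p ` A)"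
    using Iota_hom unfolding frame_hom_def und_set_def by blast
  moreover have "und_fun K p (\<Squnion>\<^bsub>FObj (Frames K) c\<^esub>A) =
      \<Squnion>\<^bsub>FObj (Frames K) (Two K)\<^esub>(und_fun K p ` A)"
    using Frames_Hom(3) [OF p] A unfolding frame_hom_def und_set_def by blast
  ultimately show ?thesis
    by (auto simp: sup_frame_two)
qed

lemma point_meet:
  assumes p: "p \<in> Hom (Cat K) c (Two K)"
    and a: "a \<in> und_set K c" and b: "b \<in> und_set K c"
  shows "Iota K (und_fun K p (a \<sqinter>\<^bsub>FObj (Frames K) c\<^esub> b)) \<longleftrightarrow>
    Iota K (und_fun K p a) \<and> Iota K (und_fun K p b)"
  using Frames_Hom(3) [OF p] Iota_hom a b und_fun_in [OF p a] und_fun_in [OF p b]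
  by (simp add: frame_hom_def und_set_def meet_frame_two)

lemma point_top:
  assumes p: "p \<in> Hom (Cat K) c (Two K)"
  shows "Iota K (und_fun K p \<top>\<^bsub>FObj (Frames K) c\<^esub>)"
  using Frames_Hom(3) [OF p] Iota_hom by (simp add: frame_hom_def top_frame_two)

text \<open>The sets \<open>{f. \<iota> (f a)}\<close> are already closed under unions and binary intersections, because
  each point preserves joins and binary meets; the whole space is the open set of the top
  element.\<close>

lemma
  assumes c: "c \<in> Obj (Cat K)"
  shows openin_pt_iff: "openin (pt K c) W \<longleftrightarrow>
      (\<exists>a \<in> und_set K c. W = {f \<in> Hom (Cat K) c (Two K). Iota K (und_fun K f a)})"
    and topspace_pt: "topspace (pt K c) = Hom (Cat K) c (Two K)"
proof -
  let ?L = "FObj (Frames K) c"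
  let ?O = "\<lambda>a. {f \<in> Hom (Cat K) c (Two K). Iota K (und_fun K f a)}"
  interpret frame ?L by (rule frame_Frames [OF c])
  have "istopology (\<lambda>W. \<exists>a \<in> und_set K c. W = ?O a)"
    unfolding istopology_def
  proof (intro conjI allI impI)
    fix S T assume "\<exists>a \<in> und_set K c. S = ?O a" "\<exists>a \<in> und_set K c. T = ?O a"
    then obtain a b where ab: "a \<in> und_set K c" "b \<in> und_set K c" "S = ?O a" "T = ?O b"
      by blast
    then have "S \<inter> T = ?O (a \<sqinter>\<^bsub>?L\<^esub> b)"
      using point_meet by auto
    moreover have "a \<sqinter>\<^bsub>?L\<^esub> b \<in> und_set K c"
      using ab by (simp add: und_set_def)
    ultimately show "\<exists>a \<in> und_set K c. S \<inter> T = ?O a" by blast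
  next
    fix \<W> assume \<W>: "\<forall>W\<in>\<W>. \<exists>a \<in> und_set K c. W = ?O a"
    let ?A = "{a \<in> und_set K c. ?O a \<in> \<W>}"
    have "\<Union>\<W> = ?O (\<Squnion>\<^bsub>?L\<^esub>?A)"
    proof
      show "\<Union>\<W> \<subseteq> ?O (\<Squnion>\<^bsub>?L\<^esub>?A)"
        using \<W> point_sup [of ?A] by fastforce
      show "?O (\<Squnion>\<^bsub>?L\<^esub>?A) \<subseteq> \<Union>\<W>"
        using point_sup [of ?A] by auto
    qed
    moreover have "\<Squnion>\<^bsub>?L\<^esub>?A \<in> und_set K c"
      unfolding und_set_def by (rule weak.sup_closed) auto
    ultimately show "\<exists>a \<in> und_set K c. \<Union>\<W> = ?O a" by blast
  qed
  then have op: "openin (pt K c) W \<longleftrightarrow> (\<exists>a \<in> und_set K c. W = ?O a)" for W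
    unfolding pt_def by (simp add: topology_inverse')
  then show "openin (pt K c) W \<longleftrightarrow> (\<exists>a \<in> und_set K c. W = ?O a)" .
  have "?O \<top>\<^bsub>?L\<^esub> = Hom (Cat K) c (Two K)"
    using point_top by auto
  then have "openin (pt K c) (Hom (Cat K) c (Two K))"
    unfolding op by (metis top_closed und_set_def)
  then show "topspace (pt K c) = Hom (Cat K) c (Two K)"
    unfolding topspace_def using op by blast
qed

lemma continuous_map_pt_iff:
  assumes c: "c \<in> Obj (Cat K)"
  shows "continuous_map X (pt K c) g \<longleftrightarrow> g \<in> topspace X \<rightarrow> Hom (Cat K) c (Two K) \<and>
     (\<forall>a \<in> und_set K c. openin X {x \<in> topspace X. Iota K (und_fun K (g x) a)})"
proof -
  have "(\<forall>W. openin (pt K c) W \<longrightarrow> openin X {x \<in> topspace X. g x \<in> W}) \<longleftrightarrow>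
      (\<forall>a \<in> und_set K c. openin X {x \<in> topspace X. Iota K (und_fun K (g x) a)})"
    if g: "g \<in> topspace X \<rightarrow> Hom (Cat K) c (Two K)"
  proof -
    let ?O = "\<lambda>a. {f \<in> Hom (Cat K) c (Two K). Iota K (und_fun K f a)}"
    have "{x \<in> topspace X. g x \<in> ?O a} = {x \<in> topspace X. Iota K (und_fun K (g x) a)}" for a
      using g by auto
    moreover have "(\<forall>W. openin (pt K c) W \<longrightarrow> openin X {x \<in> topspace X. g x \<in> W}) \<longleftrightarrow>
        (\<forall>a \<in> und_set K c. openin X {x \<in> topspace X. g x \<in> ?O a})"
      unfolding openin_pt_iff [OF c] by blast
    ultimately show ?thesis by simp
  qed
  then show ?thesis
    unfolding continuous_map_def topspace_pt [OF c] by blast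
qed

lemma eval_in_maps_to_sierpinski:
  assumes c: "c \<in> Obj (Cat K)" and a: "a \<in> und_set K c"
  shows "(\<lambda>f \<in> Hom (Cat K) c (Two K). Iota K (und_fun K f a)) \<in> maps_to_sierpinski (pt K c)"
proof -
  have "{f \<in> Hom (Cat K) c (Two K).
      (\<lambda>f \<in> Hom (Cat K) c (Two K). Iota K (und_fun K f a)) f} =
      {f \<in> Hom (Cat K) c (Two K). Iota K (und_fun K f a)}"
    by auto
  then show ?thesis
    using a unfolding maps_to_sierpinski_iff topspace_pt [OF c] openin_pt_iff [OF c] by auto
qed

end


section \<open>The adjunction of an SFC-category\<close>

lemma pt_Omega_simps:
  "LCat (pt_Omega K) = Cat K" "RCat (pt_Omega K) = op_cat (TopK K)"
  "LAdj (pt_Omega K) = pt_functor K" "RAdj (pt_Omega K) = Omega_functor K"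
  "Unit (pt_Omega K) = eta K" "Counit (pt_Omega K) = sigma K"
  "FObj (pt_functor K) = pt K" "FObj (Omega_functor K) = Omega K"
  by (simp_all add: pt_Omega_def pt_functor_def Omega_functor_def)

locale sfc_cat =
  fixes K :: "('o, 'u, 'f) sfc"
  assumes sfc: "sfc_category K"
begin

sublocale pfc_cat K
  using sfc by unfold_locales (simp add: sfc_category_def)

lemma pt_in_TopK: "c \<in> Obj (Cat K) \<Longrightarrow> in_TopK K (pt K c)"
  using sfc by (simp add: sfc_category_def)

lemma Omega_lift_Omega: "in_TopK K X \<Longrightarrow> Omega_lift K X (Omega K X) (Theta K X)"
  using sfc by (simp add: sfc_category_def)

lemma Omega_obj: "in_TopK K X \<Longrightarrow> Omega K X \<in> Obj (Cat K)"
  using Omega_lift_Omega by (simp add: Omega_lift_iff)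

lemma bij_Theta:
  "in_TopK K X \<Longrightarrow> bij_betw (Theta K X) (und_set K (Omega K X)) (maps_to_sierpinski X)"
  using Omega_lift_Omega by (simp add: Omega_lift_iff)

lemma Theta_in:
  "\<lbrakk>in_TopK K X; a \<in> und_set K (Omega K X)\<rbrakk> \<Longrightarrow> Theta K X a \<in> maps_to_sierpinski X"
  using bij_betw_apply [OF bij_Theta] .

lemma Theta_inv_in:
  "\<lbrakk>in_TopK K X; g \<in> maps_to_sierpinski X\<rbrakk> \<Longrightarrow> Theta_inv K X g \<in> und_set K (Omega K X)"
  unfolding Theta_inv_def by (rule bij_betw_apply [OF bij_betw_inv_into [OF bij_Theta]])

lemma Theta_Theta_inv:
  "\<lbrakk>in_TopK K X; g \<in> maps_to_sierpinski X\<rbrakk> \<Longrightarrow> Theta K X (Theta_inv K X g) = g"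
  unfolding Theta_inv_def by (rule bij_betw_inv_into_right [OF bij_Theta])

lemma Omega_eqI:
  assumes X: "in_TopK K X"
    and p: "p \<in> Hom (Cat K) c (Omega K X)" and q: "q \<in> Hom (Cat K) c (Omega K X)"
    and eq: "\<And>a. a \<in> und_set K c \<Longrightarrow> Theta K X (und_fun K p a) = Theta K X (und_fun K q a)"
  shows "p = q"
proof (rule arr_eqI [OF p q])
  fix a assume a: "a \<in> und_set K c"
  show "und_fun K p a = und_fun K q a"
    using bij_betw_imp_inj_on [OF bij_Theta [OF X]] und_fun_in [OF p a] und_fun_in [OF q a] eq [OF a]
    by (simp add: inj_on_def)
qed

lemma tracked_Theta_inv_iff:
  assumes X: "in_TopK K X" and d: "d \<in> Obj (Cat K)"
    and k: "\<And>a. a \<in> und_set K d \<Longrightarrow> k a \<in> maps_to_sierpinski X"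
  shows "tracked K d (Omega K X) (\<lambda>a. Theta_inv K X (k a)) \<longleftrightarrow>
    (\<forall>x \<in> topspace X. is_point K d (\<lambda>a. k a x))"
proof -
  have "(\<lambda>a. Theta_inv K X (k a)) \<in> und_set K d \<rightarrow> und_set K (Omega K X)"
    using k Theta_inv_in [OF X] by blast
  moreover have "is_point K d (\<lambda>a. Theta K X (Theta_inv K X (k a)) x) \<longleftrightarrow> is_point K d (\<lambda>a. k a x)" for x
    by (rule is_point_cong) (simp add: Theta_Theta_inv [OF X k])
  ultimately show ?thesis
    by (simp add: Omega_lift_tracked_iff [OF Omega_lift_Omega [OF X] d])
qed

lemma is_point_eval:
  "\<lbrakk>in_TopK K X; x \<in> topspace X\<rbrakk> \<Longrightarrow> is_point K (Omega K X) (\<lambda>a. Theta K X a x)"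
  by (rule Omega_lift_is_point [OF Omega_lift_Omega])

lemma
  assumes X: "in_TopK K X" and x: "x \<in> topspace X"
  shows chi_bar_hom: "chi_bar K X x \<in> Hom (Cat K) (Omega K X) (Two K)"
    and Iota_chi_bar: "a \<in> und_set K (Omega K X) \<Longrightarrow>
      Iota K (und_fun K (chi_bar K X x) a) = Theta K X a x"
proof -
  have t: "tracked K (Omega K X) (Two K) (\<lambda>a. Iota_inv K (Theta K X a x))"
    using is_point_eval [OF X x] by (simp add: tracked_Iota_inv_iff)
  show "chi_bar K X x \<in> Hom (Cat K) (Omega K X) (Two K)"
    unfolding chi_bar_def chi_def by (rule lift_of_tracked(1) [OF t])
  show "Iota K (und_fun K (chi_bar K X x) a) = Theta K X a x" if "a \<in> und_set K (Omega K X)"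
    unfolding chi_bar_def chi_def lift_of_tracked(2) [OF t that] by (rule Iota_Iota_inv)
qed

lemma comp_in_maps_to_sierpinski:
  assumes "continuous_map X Y f" "g \<in> maps_to_sierpinski Y"
  shows "compose (topspace X) g f \<in> maps_to_sierpinski X"
  using assms by (auto simp: maps_to_sierpinski_def intro: continuous_map_compose_on)

lemma
  assumes m: "m \<in> Hom (TopK K) X Y"
  shows Omega_map_hom: "FArr (Omega_functor K) m \<in> Hom (Cat K) (Omega K Y) (Omega K X)"
    and Theta_Omega_map: "b \<in> und_set K (Omega K Y) \<Longrightarrow>
      Theta K X (und_fun K (FArr (Omega_functor K) m) b) = compose (topspace X) (Theta K Y b) (cfun m)"
proof -
  have X: "in_TopK K X" and Y: "in_TopK K Y" and f: "continuous_map X Y (cfun m)"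
    and [simp]: "csrc m = X" "ctgt m = Y"
    using m by (auto simp: TopK_Hom_iff)
  let ?k = "\<lambda>b. compose (topspace X) (Theta K Y b) (cfun m)"
  have k: "?k b \<in> maps_to_sierpinski X" if "b \<in> und_set K (Omega K Y)" for b
    by (rule comp_in_maps_to_sierpinski [OF f Theta_in [OF Y that]])
  have "is_point K (Omega K Y) (\<lambda>b. ?k b x)" if "x \<in> topspace X" for x
    using is_point_eval [OF Y, of "cfun m x"] f that
    by (auto simp: compose_eq dest: continuous_map_funspace)
  then have t: "tracked K (Omega K Y) (Omega K X) (\<lambda>b. Theta_inv K X (?k b))"
    using tracked_Theta_inv_iff [OF X Omega_obj [OF Y] k] by simp
  show "FArr (Omega_functor K) m \<in> Hom (Cat K) (Omega K Y) (Omega K X)"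
    unfolding Omega_functor_def using lift_of_tracked(1) [OF t] by simp
  show "Theta K X (und_fun K (FArr (Omega_functor K) m) b) = ?k b"
    if "b \<in> und_set K (Omega K Y)"
    unfolding Omega_functor_def
    using lift_of_tracked(2) [OF t that] by (simp add: Theta_Theta_inv [OF X k [OF that]])
qed

lemma pt_map_eq:
  assumes "p \<in> Hom (Cat K) c d"
  shows "FArr (pt_functor K) p =
    CMor (pt K d) (pt K c) (\<lambda>f \<in> Hom (Cat K) d (Two K). Comp (Cat K) f p)"
  using HomD [OF assms] by (simp add: pt_functor_def)

lemma pt_map_hom:
  assumes p: "p \<in> Hom (Cat K) c d"
  shows "FArr (pt_functor K) p \<in> Hom (TopK K) (pt K d) (pt K c)"
proof -
  have c: "c \<in> Obj (Cat K)" and d: "d \<in> Obj (Cat K)"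
    using frames.source.Hom_obj [OF p] by auto
  let ?g = "\<lambda>f \<in> Hom (Cat K) d (Two K). Comp (Cat K) f p"
  have "continuous_map (pt K d) (pt K c) ?g"
    unfolding continuous_map_pt_iff [OF c]
  proof (intro conjI ballI)
    show "?g \<in> topspace (pt K d) \<rightarrow> Hom (Cat K) c (Two K)"
      using frames.source.comp_hom [OF p] by (auto simp: topspace_pt [OF d])
    fix a assume a: "a \<in> und_set K c"
    have "{f \<in> topspace (pt K d). Iota K (und_fun K (?g f) a)} =
        {f \<in> Hom (Cat K) d (Two K). Iota K (und_fun K f (und_fun K p a))}"
      using a by (auto simp: topspace_pt [OF d] und_fun_Comp [OF p])
    then show "openin (pt K d) {f \<in> topspace (pt K d). Iota K (und_fun K (?g f) a)}"
      using und_fun_in [OF p a] unfolding openin_pt_iff [OF d] by blast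
  qed
  then show ?thesis
    using c d by (simp add: pt_map_eq [OF p] TopK_Hom_iff pt_in_TopK topspace_pt)
qed

lemma is_functor_pt: "is_functor (Cat K) (op_cat (TopK K)) (pt_functor K)"
proof -
  interpret op: category "op_cat (TopK K)"
    by (rule category_op_cat [OF category_TopK])
  have obj: "FObj (pt_functor K) c = pt K c" for c
    by (simp add: pt_functor_def)
  show ?thesis
  proof
    fix a assume "a \<in> Obj (Cat K)"
    then show "FObj (pt_functor K) a \<in> Obj (op_cat (TopK K))"
      by (simp add: obj pt_in_TopK)
  next
    fix f a b assume "f \<in> Hom (Cat K) a b"
    then show "FArr (pt_functor K) f \<in> Hom (op_cat (TopK K)) (FObj (pt_functor K) a) (FObj (pt_functor K) b)"
      by (simp add: obj pt_map_hom)
  next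
    fix a assume a: "a \<in> Obj (Cat K)"
    have "(\<lambda>f \<in> Hom (Cat K) a (Two K). Comp (Cat K) f (Ide (Cat K) a)) = (\<lambda>f \<in> Hom (Cat K) a (Two K). f)"
      using frames.source.comp_ide_right by (intro restrict_ext) auto
    then show "FArr (pt_functor K) (Ide (Cat K) a) = Ide (op_cat (TopK K)) (FObj (pt_functor K) a)"
      by (simp add: obj pt_map_eq [OF frames.source.ide_hom [OF a]] topspace_pt [OF a])
  next
    fix f g a b c assume f: "f \<in> Hom (Cat K) a b" and g: "g \<in> Hom (Cat K) b c"
    have c: "c \<in> Obj (Cat K)" using frames.source.Hom_obj [OF g] by simp
    have "compose (Hom (Cat K) c (Two K)) (\<lambda>h \<in> Hom (Cat K) b (Two K). Comp (Cat K) h f)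
        (\<lambda>h \<in> Hom (Cat K) c (Two K). Comp (Cat K) h g) =
      (\<lambda>h \<in> Hom (Cat K) c (Two K). Comp (Cat K) h (Comp (Cat K) g f))"
      using frames.source.comp_hom [OF g] frames.source.comp_assoc [OF f g]
      by (auto simp: compose_def intro!: restrict_ext)
    then show "FArr (pt_functor K) (Comp (Cat K) g f) =
        Comp (op_cat (TopK K)) (FArr (pt_functor K) g) (FArr (pt_functor K) f)"
      by (simp add: pt_map_eq [OF f] pt_map_eq [OF g] topspace_pt [OF c]
          pt_map_eq [OF frames.source.comp_hom [OF f g]])
  qed
qed

lemma is_functor_Omega: "is_functor (op_cat (TopK K)) (Cat K) (Omega_functor K)"
proof -
  interpret T: category "TopK K" by (rule category_TopK)
  interpret op: category "op_cat (TopK K)"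
    by (rule category_op_cat [OF category_TopK])
  have obj: "FObj (Omega_functor K) X = Omega K X" for X
    by (simp add: Omega_functor_def)
  show ?thesis
  proof
    fix X assume "X \<in> Obj (op_cat (TopK K))"
    then show "FObj (Omega_functor K) X \<in> Obj (Cat K)"
      by (simp add: obj Omega_obj)
  next
    fix m X Y assume "m \<in> Hom (op_cat (TopK K)) X Y"
    then show "FArr (Omega_functor K) m \<in> Hom (Cat K) (FObj (Omega_functor K) X) (FObj (Omega_functor K) Y)"
      by (simp add: obj Omega_map_hom)
  next
    fix X assume "X \<in> Obj (op_cat (TopK K))"
    then have X: "in_TopK K X" by simp
    have I: "Ide (TopK K) X \<in> Hom (TopK K) X X"
      by (rule T.ide_hom) (simp add: X)
    have "FArr (Omega_functor K) (Ide (TopK K) X) = Ide (Cat K) (Omega K X)"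
    proof (rule Omega_eqI [OF X Omega_map_hom [OF I]])
      show "Ide (Cat K) (Omega K X) \<in> Hom (Cat K) (Omega K X) (Omega K X)"
        by (rule frames.source.ide_hom [OF Omega_obj [OF X]])
      fix a assume a: "a \<in> und_set K (Omega K X)"
      have "compose (topspace X) (Theta K X a) (\<lambda>x \<in> topspace X. x) = Theta K X a"
        using Theta_in [OF X a]
        by (intro extensionalityI [of _ "topspace X"])
          (auto simp: maps_to_sierpinski_iff compose_eq)
      then show "Theta K X (und_fun K (FArr (Omega_functor K) (Ide (TopK K) X)) a) =
          Theta K X (und_fun K (Ide (Cat K) (Omega K X)) a)"
        unfolding Theta_Omega_map [OF I a] by (simp add: und_fun_Ide [OF Omega_obj [OF X] a])
    qed
    then show "FArr (Omega_functor K) (Ide (op_cat (TopK K)) X) = Ide (Cat K) (FObj (Omega_functor K) X)"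
      by (simp add: obj)
  next
    fix m n X Y Z
    assume "m \<in> Hom (op_cat (TopK K)) X Y" "n \<in> Hom (op_cat (TopK K)) Y Z"
    then have m: "m \<in> Hom (TopK K) Y X" and n: "n \<in> Hom (TopK K) Z Y" by simp_all
    have mn: "Comp (TopK K) m n \<in> Hom (TopK K) Z X"
      by (rule T.comp_hom [OF n m])
    have Z: "in_TopK K Z" using n by (simp add: TopK_Hom_iff)
    have n_in: "cfun n x \<in> topspace Y" if "x \<in> topspace Z" for x
      using n that by (auto simp: TopK_Hom_iff dest: continuous_map_funspace)
    show "FArr (Omega_functor K) (Comp (op_cat (TopK K)) n m) =
        Comp (Cat K) (FArr (Omega_functor K) n) (FArr (Omega_functor K) m)"
      unfolding op_cat_simps
    proof (rule Omega_eqI [OF Z Omega_map_hom [OF mn]])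
      show "Comp (Cat K) (FArr (Omega_functor K) n) (FArr (Omega_functor K) m) \<in> Hom (Cat K) (Omega K X) (Omega K Z)"
        by (rule frames.source.comp_hom [OF Omega_map_hom [OF m] Omega_map_hom [OF n]])
      fix a assume a: "a \<in> und_set K (Omega K X)"
      note a' = und_fun_in [OF Omega_map_hom [OF m] a]
      have "compose (topspace Z) (Theta K X a) (cfun (Comp (TopK K) m n)) =
          compose (topspace Z) (compose (topspace Y) (Theta K X a) (cfun m)) (cfun n)"
        using n n_in by (auto simp: TopK_Hom_iff compose_def intro!: restrict_ext)
      then show "Theta K Z (und_fun K (FArr (Omega_functor K) (Comp (TopK K) m n)) a) =
          Theta K Z (und_fun K (Comp (Cat K) (FArr (Omega_functor K) n) (FArr (Omega_functor K) m)) a)"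
        unfolding Theta_Omega_map [OF mn a] und_fun_Comp [OF Omega_map_hom [OF m] Omega_map_hom [OF n] a]
          Theta_Omega_map [OF n a'] Theta_Omega_map [OF m a] .
    qed
  qed
qed

lemma
  assumes c: "c \<in> Obj (Cat K)"
  shows eta_hom: "eta K c \<in> Hom (Cat K) c (Omega K (pt K c))"
    and Theta_eta: "a \<in> und_set K c \<Longrightarrow> Theta K (pt K c) (und_fun K (eta K c) a) =
      (\<lambda>f \<in> Hom (Cat K) c (Two K). Iota K (und_fun K f a))"
proof -
  note X = pt_in_TopK [OF c]
  let ?k = "\<lambda>a. \<lambda>f \<in> Hom (Cat K) c (Two K). Iota K (und_fun K f a)"
  let ?P = "\<lambda>p. p \<in> Hom (Cat K) c (Omega K (pt K c)) \<and>
      (\<forall>a \<in> und_set K c. Theta K (pt K c) (und_fun K p a) = ?k a)"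
  have k: "?k a \<in> maps_to_sierpinski (pt K c)" if "a \<in> und_set K c" for a
    by (rule eval_in_maps_to_sierpinski [OF c that])
  have "is_point K c (\<lambda>a. ?k a f)" if "f \<in> topspace (pt K c)" for f
    using that by (auto simp: topspace_pt [OF c] is_point_def)
  then have "tracked K c (Omega K (pt K c)) (\<lambda>a. Theta_inv K (pt K c) (?k a))"
    using tracked_Theta_inv_iff [OF X c k] by simp
  then obtain p where p: "p \<in> Hom (Cat K) c (Omega K (pt K c))"
      "\<And>a. a \<in> und_set K c \<Longrightarrow> und_fun K p a = Theta_inv K (pt K c) (?k a)"
    by (auto simp: tracked_def)
  have "?P p"
    using p Theta_Theta_inv [OF X k] by simp
  moreover have "q = p" if "?P q" for q
    using that \<open>?P p\<close> by (intro Omega_eqI [OF X]) auto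
  ultimately have "?P (eta K c)"
    unfolding eta_def by (rule theI)
  then show "eta K c \<in> Hom (Cat K) c (Omega K (pt K c))"
    and "a \<in> und_set K c \<Longrightarrow> Theta K (pt K c) (und_fun K (eta K c) a) = ?k a"
    by blast+
qed

lemma sigma_hom:
  assumes X: "in_TopK K X"
  shows "sigma K X \<in> Hom (TopK K) X (pt K (Omega K X))"
proof -
  note O = Omega_obj [OF X]
  have "continuous_map X (pt K (Omega K X)) (\<lambda>x \<in> topspace X. chi_bar K X x)"
    unfolding continuous_map_pt_iff [OF O]
  proof (intro conjI ballI)
    show "(\<lambda>x \<in> topspace X. chi_bar K X x) \<in> topspace X \<rightarrow> Hom (Cat K) (Omega K X) (Two K)"
      using chi_bar_hom [OF X] by auto
    fix a assume a: "a \<in> und_set K (Omega K X)"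
    have "{x \<in> topspace X. Iota K (und_fun K ((\<lambda>x \<in> topspace X. chi_bar K X x) x) a)} =
        {x \<in> topspace X. Theta K X a x}"
      using Iota_chi_bar [OF X _ a] by auto
    then show "openin X {x \<in> topspace X. Iota K (und_fun K ((\<lambda>x \<in> topspace X. chi_bar K X x) x) a)}"
      using Theta_in [OF X a] by (simp add: maps_to_sierpinski_iff)
  qed
  then show ?thesis
    using X by (simp add: sigma_def TopK_Hom_iff pt_in_TopK [OF O])
qed

lemma cfun_pt_map:
  "\<lbrakk>p \<in> Hom (Cat K) c d; f \<in> Hom (Cat K) d (Two K)\<rbrakk> \<Longrightarrow>
    cfun (FArr (pt_functor K) p) f = Comp (Cat K) f p"
  by (simp add: pt_map_eq)

lemma cfun_sigma: "x \<in> topspace X \<Longrightarrow> cfun (sigma K X) x = chi_bar K X x"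
  by (simp add: sigma_def)

lemma nat_trans_eta:
  "nat_trans (Cat K) (Cat K) id_functor (comp_functor (Omega_functor K) (pt_functor K)) (eta K)"
proof -
  interpret i: is_functor "Cat K" "Cat K" id_functor
    by (rule is_functor_id) (rule frames.source.category_axioms)
  interpret OP: is_functor "Cat K" "Cat K" "comp_functor (Omega_functor K) (pt_functor K)"
    by (rule is_functor_comp [OF is_functor_pt is_functor_Omega])
  show ?thesis
  proof
    fix c assume "c \<in> Obj (Cat K)"
    then show "eta K c \<in> Hom (Cat K) (FObj id_functor c) (FObj (comp_functor (Omega_functor K) (pt_functor K)) c)"
      by (simp add: eta_hom pt_Omega_simps)
  next
    fix p c d assume p: "p \<in> Hom (Cat K) c d"
    have c: "c \<in> Obj (Cat K)" and d: "d \<in> Obj (Cat K)"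
      using frames.source.Hom_obj [OF p] by auto
    note P = pt_map_hom [OF p]
    note O = Omega_map_hom [OF P]
    have "Comp (Cat K) (eta K d) p = Comp (Cat K) (FArr (Omega_functor K) (FArr (pt_functor K) p)) (eta K c)"
    proof (rule Omega_eqI [OF pt_in_TopK [OF d]])
      show "Comp (Cat K) (eta K d) p \<in> Hom (Cat K) c (Omega K (pt K d))"
        by (rule frames.source.comp_hom [OF p eta_hom [OF d]])
      show "Comp (Cat K) (FArr (Omega_functor K) (FArr (pt_functor K) p)) (eta K c)
          \<in> Hom (Cat K) c (Omega K (pt K d))"
        by (rule frames.source.comp_hom [OF eta_hom [OF c] O])
      fix a assume a: "a \<in> und_set K c"
      have "(\<lambda>f \<in> Hom (Cat K) d (Two K). Iota K (und_fun K f (und_fun K p a))) =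
          compose (Hom (Cat K) d (Two K)) (\<lambda>f \<in> Hom (Cat K) c (Two K). Iota K (und_fun K f a))
            (\<lambda>f \<in> Hom (Cat K) d (Two K). Comp (Cat K) f p)"
        using frames.source.comp_hom [OF p] a
        by (auto simp: compose_def und_fun_Comp [OF p] intro!: restrict_ext)
      then show "Theta K (pt K d) (und_fun K (Comp (Cat K) (eta K d) p) a) =
          Theta K (pt K d) (und_fun K (Comp (Cat K)
            (FArr (Omega_functor K) (FArr (pt_functor K) p)) (eta K c)) a)"
        unfolding und_fun_Comp [OF p eta_hom [OF d] a] und_fun_Comp [OF eta_hom [OF c] O a]
          Theta_Omega_map [OF P und_fun_in [OF eta_hom [OF c] a]]
          Theta_eta [OF d und_fun_in [OF p a]] Theta_eta [OF c a]
        by (simp add: pt_map_eq [OF p] topspace_pt [OF d])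
    qed
    then show "Comp (Cat K) (eta K d) (FArr id_functor p) =
        Comp (Cat K) (FArr (comp_functor (Omega_functor K) (pt_functor K)) p) (eta K c)"
      by simp
  qed
qed

lemma nat_trans_sigma:
  "nat_trans (op_cat (TopK K)) (op_cat (TopK K)) (comp_functor (pt_functor K) (Omega_functor K))
     id_functor (sigma K)"
proof -
  interpret T: category "TopK K" by (rule category_TopK)
  interpret i: is_functor "op_cat (TopK K)" "op_cat (TopK K)" id_functor
    by (rule is_functor_id) (rule category_op_cat [OF category_TopK])
  interpret PO: is_functor "op_cat (TopK K)" "op_cat (TopK K)" "comp_functor (pt_functor K) (Omega_functor K)"
    by (rule is_functor_comp [OF is_functor_Omega is_functor_pt])
  show ?thesis
  proof
    fix X assume "X \<in> Obj (op_cat (TopK K))"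
    then show "sigma K X \<in> Hom (op_cat (TopK K))
        (FObj (comp_functor (pt_functor K) (Omega_functor K)) X) (FObj id_functor X)"
      by (simp add: sigma_hom pt_Omega_simps)
  next
    fix m X Y assume "m \<in> Hom (op_cat (TopK K)) X Y"
    then have m: "m \<in> Hom (TopK K) Y X" by simp
    then have X: "in_TopK K X" and Y: "in_TopK K Y" by (auto simp: TopK_Hom_iff)
    note O = Omega_map_hom [OF m]
    note P = pt_map_hom [OF O]
    have "Comp (TopK K) (FArr (pt_functor K) (FArr (Omega_functor K) m)) (sigma K Y) =
        Comp (TopK K) (sigma K X) m"
    proof (rule TopK_eqI)
      show "Comp (TopK K) (FArr (pt_functor K) (FArr (Omega_functor K) m)) (sigma K Y)
          \<in> Hom (TopK K) Y (pt K (Omega K X))"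
        by (rule T.comp_hom [OF sigma_hom [OF Y] P])
      show "Comp (TopK K) (sigma K X) m \<in> Hom (TopK K) Y (pt K (Omega K X))"
        by (rule T.comp_hom [OF m sigma_hom [OF X]])
      fix y assume y: "y \<in> topspace Y"
      note chi_y = chi_bar_hom [OF Y y]
      note my = Hom_TopK_in [OF m y]
      have "Comp (Cat K) (chi_bar K Y y) (FArr (Omega_functor K) m) = chi_bar K X (cfun m y)"
      proof (rule point_eqI [OF frames.source.comp_hom [OF O chi_y] chi_bar_hom [OF X my]])
        fix a assume a: "a \<in> und_set K (Omega K X)"
        show "Iota K (und_fun K (Comp (Cat K) (chi_bar K Y y) (FArr (Omega_functor K) m)) a) =
            Iota K (und_fun K (chi_bar K X (cfun m y)) a)"
          unfolding und_fun_Comp [OF O chi_y a] Iota_chi_bar [OF Y y und_fun_in [OF O a]]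
            Iota_chi_bar [OF X my a] Theta_Omega_map [OF m a]
          by (rule compose_eq [OF y])
      qed
      then show "cfun (Comp (TopK K) (FArr (pt_functor K) (FArr (Omega_functor K) m)) (sigma K Y)) y =
          cfun (Comp (TopK K) (sigma K X) m) y"
        unfolding cfun_Comp_TopK [OF m y] cfun_Comp_TopK [OF sigma_hom [OF Y] y]
          cfun_sigma [OF y] cfun_sigma [OF my] cfun_pt_map [OF O chi_y] .
    qed
    then show "Comp (op_cat (TopK K)) (sigma K Y) (FArr (comp_functor (pt_functor K) (Omega_functor K)) m) =
        Comp (op_cat (TopK K)) (FArr id_functor m) (sigma K X)"
      unfolding op_cat_simps comp_functor_simps id_functor_simps .
  qed
qed

text \<open>In \<open>Top\<close> the counit \<open>\<sigma>\<close> points from \<open>X\<close> to \<open>pt (\<Omega> X)\<close>, so the first triangle identity is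
  composed there in the order opposite to that of the adjunction.\<close>

lemma triangle_pt:
  assumes c: "c \<in> Obj (Cat K)"
  shows "Comp (TopK K) (FArr (pt_functor K) (eta K c)) (sigma K (pt K c)) = Ide (TopK K) (pt K c)"
proof -
  interpret T: category "TopK K" by (rule category_TopK)
  note X = pt_in_TopK [OF c]
  note e = eta_hom [OF c]
  note s = sigma_hom [OF X]
  show ?thesis
  proof (rule TopK_eqI)
    show "Comp (TopK K) (FArr (pt_functor K) (eta K c)) (sigma K (pt K c)) \<in> Hom (TopK K) (pt K c) (pt K c)"
      by (rule T.comp_hom [OF s pt_map_hom [OF e]])
    show "Ide (TopK K) (pt K c) \<in> Hom (TopK K) (pt K c) (pt K c)"
      by (rule T.ide_hom) (simp add: X)
    fix f assume f: "f \<in> topspace (pt K c)"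
    then have f': "f \<in> Hom (Cat K) c (Two K)" by (simp add: topspace_pt [OF c])
    note chi = chi_bar_hom [OF X f]
    have "Comp (Cat K) (chi_bar K (pt K c) f) (eta K c) = f"
    proof (rule point_eqI [OF frames.source.comp_hom [OF e chi] f'])
      fix a assume a: "a \<in> und_set K c"
      show "Iota K (und_fun K (Comp (Cat K) (chi_bar K (pt K c) f) (eta K c)) a) = Iota K (und_fun K f a)"
        unfolding und_fun_Comp [OF e chi a] Iota_chi_bar [OF X f und_fun_in [OF e a]] Theta_eta [OF c a]
        using f' by simp
    qed
    then show "cfun (Comp (TopK K) (FArr (pt_functor K) (eta K c)) (sigma K (pt K c))) f =
        cfun (Ide (TopK K) (pt K c)) f"
      unfolding cfun_Comp_TopK [OF s f] cfun_sigma [OF f] cfun_pt_map [OF e chi]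
      using f by simp
  qed
qed

lemma triangle_Omega:
  assumes X: "in_TopK K X"
  shows "Comp (Cat K) (FArr (Omega_functor K) (sigma K X)) (eta K (Omega K X)) = Ide (Cat K) (Omega K X)"
proof -
  note c = Omega_obj [OF X]
  note e = eta_hom [OF c]
  note s = sigma_hom [OF X]
  show ?thesis
  proof (rule Omega_eqI [OF X frames.source.comp_hom [OF e Omega_map_hom [OF s]] frames.source.ide_hom [OF c]])
    fix a assume a: "a \<in> und_set K (Omega K X)"
    have "compose (topspace X) (\<lambda>f \<in> Hom (Cat K) (Omega K X) (Two K). Iota K (und_fun K f a))
        (cfun (sigma K X)) = Theta K X a"
      using Theta_in [OF X a] chi_bar_hom [OF X] Iota_chi_bar [OF X _ a]
      by (intro extensionalityI [of _ "topspace X"])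
        (auto simp: maps_to_sierpinski_iff compose_eq cfun_sigma)
    then show "Theta K X (und_fun K (Comp (Cat K) (FArr (Omega_functor K) (sigma K X)) (eta K (Omega K X))) a) =
        Theta K X (und_fun K (Ide (Cat K) (Omega K X)) a)"
      unfolding und_fun_Comp [OF e Omega_map_hom [OF s] a]
        Theta_Omega_map [OF s und_fun_in [OF e a]] Theta_eta [OF c a] und_fun_Ide [OF c a] .
  qed
qed

theorem adjunction_pt_Omega: "adjunction (pt_Omega K)"
  unfolding adjunction_def pt_Omega_simps
  using is_functor_pt is_functor_Omega nat_trans_eta nat_trans_sigma triangle_pt triangle_Omega
  by (simp del: TopK_simps(2,3))

end

section \<open>The comparison morphisms of an SFC-functor\<close>

lemma Frm_cat_iso_bij:
  assumes "iso_arr Frm_cat h" "h \<in> Hom Frm_cat L M"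
  shows "bij_betw (cfun h) (carrier L) (carrier M)"
proof -
  have h: "csrc h = L" "ctgt h = M" "cfun h \<in> carrier L \<rightarrow> carrier M"
    using assms(2) by (auto simp: Frm_cat_Hom_iff frame_hom_def)
  have DC: "Dom Frm_cat h = L" "Cod Frm_cat h = M"
    using assms(2) by (auto simp: HomD)
  obtain k where k: "k \<in> Hom Frm_cat M L"
      "Comp Frm_cat k h = Ide Frm_cat L" "Comp Frm_cat h k = Ide Frm_cat M"
    using assms(1) by (auto simp: iso_arr_def DC)
  have k': "csrc k = M" "ctgt k = L" "cfun k \<in> carrier M \<rightarrow> carrier L"
    using k(1) by (auto simp: Frm_cat_Hom_iff frame_hom_def)
  have "compose (carrier L) (cfun k) (cfun h) = (\<lambda>a \<in> carrier L. a)"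
      "compose (carrier M) (cfun h) (cfun k) = (\<lambda>b \<in> carrier M. b)"
    using k(2,3) h(1,2) k'(1,2) by (simp_all add: Frm_cat_def concrete_cat_def)
  then have "cfun k (cfun h a) = a" "cfun h (cfun k b) = b"
    if "a \<in> carrier L" "b \<in> carrier M" for a b
    using that by (metis compose_eq restrict_apply')+
  then show ?thesis
    using h(3) k'(3) by (intro bij_betwI [where g = "cfun k"]) (blast | auto)+
qed

text \<open>An SFC-functor between SFC-categories that share their types of points and of frame elements.\<close>

locale sfc_fun = C: sfc_cat C + D: sfc_cat D
  for C :: "('o, 'u, 'f) sfc" and D :: "('p, 'u, 'f) sfc" +
  fixes H :: "('o, 'u, 'p, 'u) cfunctor"
    and \<alpha> :: "'o \<Rightarrow> ('f gorder, 'f) cmor" and i :: 'u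
  assumes sfc_functor: "sfc_functor C D H \<alpha> i"
begin

lemma pfc_functor: "pfc_functor C D H \<alpha> i"
  using sfc_functor by (simp add: sfc_functor_def)

sublocale H: is_functor "Cat C" "Cat D" H
  using pfc_functor by (simp add: pfc_functor_def)

sublocale alpha: nat_trans "Cat C" Frm_cat "comp_functor (Frames D) H" "Frames C" \<alpha>
  using pfc_functor by (simp add: pfc_functor_def nat_iso_def)

lemma bij_alpha:
  assumes "c \<in> Obj (Cat C)"
  shows "bij_betw (cfun (\<alpha> c)) (und_set D (FObj H c)) (und_set C c)"
proof -
  have "iso_arr Frm_cat (\<alpha> c)"
    using pfc_functor assms by (simp add: pfc_functor_def nat_iso_def)
  then show ?thesis
    using Frm_cat_iso_bij alpha.component [OF assms] by (simp add: und_set_def)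
qed

lemma alpha_in:
  "\<lbrakk>c \<in> Obj (Cat C); a \<in> und_set D (FObj H c)\<rbrakk> \<Longrightarrow> cfun (\<alpha> c) a \<in> und_set C c"
  by (rule bij_betw_apply [OF bij_alpha])

lemma alpha_natural:
  assumes p: "p \<in> Hom (Cat C) c d" and a: "a \<in> und_set D (FObj H c)"
  shows "cfun (\<alpha> d) (und_fun D (FArr H p) a) = und_fun C p (cfun (\<alpha> c) a)"
proof -
  have c: "c \<in> Obj (Cat C)" using C.frames.source.Hom_obj [OF p] by simp
  have "csrc (\<alpha> c) = FObj (Frames D) (FObj H c)"
    using alpha.component [OF c] by (simp add: Frm_cat_Hom_iff)
  then have "cfun (Comp Frm_cat (\<alpha> d) (FArr (Frames D) (FArr H p))) a =
        cfun (\<alpha> d) (und_fun D (FArr H p) a)"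
      "cfun (Comp Frm_cat (FArr (Frames C) p) (\<alpha> c)) a = und_fun C p (cfun (\<alpha> c) a)"
    using a by (simp_all add: D.Frames_Hom(1) [OF H.map_hom [OF p]] C.Frames_Hom(1) [OF p]
        Frm_cat_def concrete_cat_def und_set_def compose_eq)
  then show ?thesis
    using alpha.natural [OF p] by simp
qed

lemma i_hom: "i \<in> Hom (Cat D) (FObj H (Two C)) (Two D)"
  using pfc_functor by (simp add: pfc_functor_def)

lemma Iota_i: "a \<in> und_set D (FObj H (Two C)) \<Longrightarrow>
    Iota D (und_fun D i a) = Iota C (cfun (\<alpha> (Two C)) a)"
  using pfc_functor by (simp add: pfc_functor_def)

lemma i_inverse:
  obtains j where "j \<in> Hom (Cat D) (Two D) (FObj H (Two C))" "Comp (Cat D) i j = Ide (Cat D) (Two D)"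
  using pfc_functor HomD [OF i_hom] by (auto simp: pfc_functor_def iso_arr_def)

text \<open>Composition with the isomorphism \<open>i\<close> identifies arrows \<open>d \<rightarrow> H 2\<close> with points of \<open>d\<close>. The
  function into \<open>|O (H 2)|\<close> in the statement is \<open>\<alpha>\<^sup>-\<^sup>1 \<circ> \<iota>\<^sup>-\<^sup>1 \<circ> u\<close>, the form in which the family of
  the preserved cartesian lift is given.\<close>

lemma tracked_H_Two_iff:
  "tracked D d (FObj H (Two C))
     (\<lambda>a. inv_into (und_set D (FObj H (Two C))) (cfun (\<alpha> (Two C))) (Iota_inv C (u a)))
   \<longleftrightarrow> is_point D d u"
proof -
  let ?T = "FObj H (Two C)"
  have eq: "b = inv_into (und_set D ?T) (cfun (\<alpha> (Two C))) (Iota_inv C v) \<longleftrightarrow>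
      Iota D (und_fun D i b) = v" if b: "b \<in> und_set D ?T" for b v
  proof -
    note bij = bij_alpha [OF C.Two_obj]
    have "Iota_inv C v \<in> und_set C (Two C)"
      unfolding Iota_inv_def by (rule bij_betw_apply [OF bij_betw_inv_into [OF C.bij_Iota]]) simp
    then have "b = inv_into (und_set D ?T) (cfun (\<alpha> (Two C))) (Iota_inv C v) \<longleftrightarrow>
        cfun (\<alpha> (Two C)) b = Iota_inv C v"
      using bij_betw_inv_into_left [OF bij b] bij_betw_inv_into_right [OF bij] by metis
    then show ?thesis
      using C.Iota_inv_eq_iff [OF alpha_in [OF C.Two_obj b]] Iota_i [OF b] by simp
  qed
  show ?thesis
  proof
    assume "tracked D d ?T (\<lambda>a. inv_into (und_set D ?T) (cfun (\<alpha> (Two C))) (Iota_inv C (u a)))"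
    then obtain p where p: "p \<in> Hom (Cat D) d ?T"
        "\<And>a. a \<in> und_set D d \<Longrightarrow> Iota D (und_fun D i (und_fun D p a)) = u a"
      unfolding tracked_def using eq D.und_fun_in by metis
    have "Comp (Cat D) i p \<in> Hom (Cat D) d (Two D)"
      by (rule D.frames.source.comp_hom [OF p(1) i_hom])
    moreover have "Iota D (und_fun D (Comp (Cat D) i p) a) = u a" if "a \<in> und_set D d" for a
      using p(2) that by (simp add: D.und_fun_Comp [OF p(1) i_hom])
    ultimately show "is_point D d u" by (auto simp: is_point_def)
  next
    assume "is_point D d u"
    then obtain q where q: "q \<in> Hom (Cat D) d (Two D)" "\<And>a. a \<in> und_set D d \<Longrightarrow> Iota D (und_fun D q a) = u a"
      by (auto simp: is_point_def)
    obtain j where j: "j \<in> Hom (Cat D) (Two D) ?T" "Comp (Cat D) i j = Ide (Cat D) (Two D)"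
      by (rule i_inverse)
    have jq: "Comp (Cat D) j q \<in> Hom (Cat D) d ?T"
      by (rule D.frames.source.comp_hom [OF q(1) j(1)])
    have ij: "Comp (Cat D) i (Comp (Cat D) j q) = q"
      using D.frames.source.comp_assoc [OF q(1) j(1) i_hom] j(2)
        D.frames.source.comp_ide_left [OF q(1)] by simp
    have "und_fun D (Comp (Cat D) j q) a =
        inv_into (und_set D ?T) (cfun (\<alpha> (Two C))) (Iota_inv C (u a))" if a: "a \<in> und_set D d" for a
      unfolding eq [OF D.und_fun_in [OF jq a]] D.und_fun_Comp [OF jq i_hom a, symmetric] ij
      by (rule q(2) [OF a])
    with jq show "tracked D d ?T (\<lambda>a. inv_into (und_set D ?T) (cfun (\<alpha> (Two C))) (Iota_inv C (u a)))"
      by (auto simp: tracked_def)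
  qed
qed

text \<open>The map \<open>\<theta> \<circ> \<alpha>\<close> from \<open>|O (H (\<Omega>\<^sub>C X))|\<close> to the set of maps from \<open>X\<close> to the Sierpinski
  space, for \<open>X\<close> in \<open>Top\<^sub>C\<close>: along it, \<open>H (\<Omega>\<^sub>C X)\<close> is a cartesian lift in \<open>D\<close>.\<close>

definition H_Theta :: "'u topology \<Rightarrow> 'f \<Rightarrow> 'u \<Rightarrow> bool" where
  "H_Theta X a = Theta C X (cfun (\<alpha> (Omega C X)) a)"

lemma Omega_lift_H:
  assumes "in_TopK C X"
  shows "Omega_lift D X (FObj H (Omega C X)) (H_Theta X)"
proof -
  have "cartesian_lift (Cat D) (und D) (FObj H (Two C)) (topspace X) (maps_to_sierpinski X)
      (\<lambda>x g. inv_into (und_set D (FObj H (Two C))) (cfun (\<alpha> (Two C))) (Iota_inv C (chi x g)))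
      (FObj H (Omega C X)) (H_Theta X)"
    using sfc_functor assms by (simp add: sfc_functor_def H_Theta_def [abs_def])
  then show ?thesis
    unfolding D.cartesian_lift_iff_tracked D.Omega_lift_iff tracked_H_Two_iff chi_def .
qed

lemma TopK_mono:
  fixes X :: "'u topology"
  assumes "in_TopK C X"
  shows "in_TopK D X"
  using Omega_lift_H [OF assms] unfolding in_TopK_def [of D] by blast

lemma H_Omega_obj: "in_TopK C X \<Longrightarrow> FObj H (Omega C X) \<in> Obj (Cat D)"
  by (rule H.map_obj [OF C.Omega_obj])

lemma bij_H_Theta:
  "in_TopK C X \<Longrightarrow> bij_betw (H_Theta X) (und_set D (FObj H (Omega C X))) (maps_to_sierpinski X)"
  using Omega_lift_H by (simp add: D.Omega_lift_iff)

lemma H_Theta_in: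
  "\<lbrakk>in_TopK C X; a \<in> und_set D (FObj H (Omega C X))\<rbrakk> \<Longrightarrow> H_Theta X a \<in> maps_to_sierpinski X"
  by (rule bij_betw_apply [OF bij_H_Theta])

lemma tracked_zeta:
  assumes X: "in_TopK C X"
  shows "tracked D (FObj H (Omega C X)) (Omega D X) (\<lambda>a. Theta_inv D X (H_Theta X a))"
  using D.tracked_Theta_inv_iff [OF TopK_mono [OF X] H_Omega_obj [OF X] H_Theta_in [OF X]]
    D.Omega_lift_is_point [OF Omega_lift_H [OF X]] by simp

lemma lifts_zeta:
  assumes X: "in_TopK C X"
  shows "lifts (Cat D) (und D) (FObj H (Omega C X)) (Omega D X) (zeta_fun C D H \<alpha> X)"
  using tracked_zeta [OF X] unfolding zeta_fun_def H_Theta_def D.lifts_iff_tracked .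

lemma
  assumes X: "in_TopK C X"
  shows zeta_hom: "zeta C D H \<alpha> X \<in> Hom (Cat D) (FObj H (Omega C X)) (Omega D X)"
    and Theta_zeta: "a \<in> und_set D (FObj H (Omega C X)) \<Longrightarrow>
      Theta D X (und_fun D (zeta C D H \<alpha> X) a) = H_Theta X a"
proof -
  note t = D.lift_of_tracked [OF tracked_zeta [OF X]]
  show "zeta C D H \<alpha> X \<in> Hom (Cat D) (FObj H (Omega C X)) (Omega D X)"
    using t(1) unfolding zeta_def zeta_fun_def H_Theta_def .
  show "Theta D X (und_fun D (zeta C D H \<alpha> X) a) = H_Theta X a"
    if a: "a \<in> und_set D (FObj H (Omega C X))"
  proof -
    have "und_fun D (zeta C D H \<alpha> X) a = Theta_inv D X (H_Theta X a)"
      using t(2) [OF a] unfolding zeta_def zeta_fun_def H_Theta_def .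
    then show ?thesis
      by (simp add: D.Theta_Theta_inv [OF TopK_mono [OF X] H_Theta_in [OF X a]])
  qed
qed

lemma iso_zeta:
  assumes X: "in_TopK C X"
  shows "iso_arr (Cat D) (zeta C D H \<alpha> X)"
proof -
  let ?Z = "FObj H (Omega C X)"
  \<comment> \<open>The inverse of \<open>\<zeta>\<close> is obtained by lifting this function along the cartesian lift \<open>?Z\<close>.\<close>
  let ?h = "\<lambda>b. inv_into (und_set D ?Z) (H_Theta X) (Theta D X b)"
  note X' = TopK_mono [OF X]
  have h_in: "?h b \<in> und_set D ?Z" and H_Theta_h: "H_Theta X (?h b) = Theta D X b"
    if "b \<in> und_set D (Omega D X)" for b
    using bij_betw_apply [OF bij_betw_inv_into [OF bij_H_Theta [OF X]] D.Theta_in [OF X' that]]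
      bij_betw_inv_into_right [OF bij_H_Theta [OF X] D.Theta_in [OF X' that]] by auto
  have "is_point D (Omega D X) (\<lambda>b. H_Theta X (?h b) x)" if "x \<in> topspace X" for x
    using D.is_point_eval [OF X' that] H_Theta_h by (simp cong: is_point_cong)
  then have "tracked D (Omega D X) ?Z ?h"
    using D.Omega_lift_tracked_iff [OF Omega_lift_H [OF X] D.Omega_obj [OF X'], of ?h] h_in
    by blast
  then obtain q where q: "q \<in> Hom (Cat D) (Omega D X) ?Z"
      "\<And>b. b \<in> und_set D (Omega D X) \<Longrightarrow> und_fun D q b = ?h b"
    by (auto simp: tracked_def)
  show ?thesis
  proof (rule D.iso_arr_und_fun [OF zeta_hom [OF X] q(1)])
    fix a assume a: "a \<in> und_set D ?Z"
    show "und_fun D q (und_fun D (zeta C D H \<alpha> X) a) = a"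
      using q(2) [OF D.und_fun_in [OF zeta_hom [OF X] a]]
        bij_betw_inv_into_left [OF bij_H_Theta [OF X] a] by (simp add: Theta_zeta [OF X a])
  next
    fix b assume b: "b \<in> und_set D (Omega D X)"
    have "und_fun D (zeta C D H \<alpha> X) (?h b) \<in> und_set D (Omega D X)"
      by (rule D.und_fun_in [OF zeta_hom [OF X] h_in [OF b]])
    moreover have "Theta D X (und_fun D (zeta C D H \<alpha> X) (?h b)) = Theta D X b"
      unfolding Theta_zeta [OF X h_in [OF b]] by (rule H_Theta_h [OF b])
    ultimately show "und_fun D (zeta C D H \<alpha> X) (und_fun D q b) = b"
      using bij_betw_imp_inj_on [OF D.bij_Theta [OF X']] b by (simp add: q(2) [OF b] inj_on_def)
  qed
qed

lemma Hom_TopK_mono: "m \<in> Hom (TopK C) X Y \<Longrightarrow> m \<in> Hom (TopK D) X Y"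
  by (auto simp: TopK_Hom_iff TopK_mono)

lemma is_functor_inclusion: "is_functor (op_cat (TopK C)) (op_cat (TopK D)) id_functor"
proof -
  interpret C': category "op_cat (TopK C)"
    by (rule category_op_cat [OF category_TopK])
  interpret D': category "op_cat (TopK D)"
    by (rule category_op_cat [OF category_TopK])
  show ?thesis
    by unfold_locales (auto intro: Hom_TopK_mono TopK_mono)
qed

lemma nat_trans_zeta:
  "nat_trans (op_cat (TopK C)) (Cat D) (comp_functor H (Omega_functor C))
     (comp_functor (Omega_functor D) id_functor) (zeta C D H \<alpha>)"
proof -
  interpret HO: is_functor "op_cat (TopK C)" "Cat D" "comp_functor H (Omega_functor C)"
    by (rule is_functor_comp [OF C.is_functor_Omega H.is_functor_axioms])
  interpret OI: is_functor "op_cat (TopK C)" "Cat D" "comp_functor (Omega_functor D) id_functor"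
    by (rule is_functor_comp [OF is_functor_inclusion D.is_functor_Omega])
  show ?thesis
  proof
    fix X assume "X \<in> Obj (op_cat (TopK C))"
    then show "zeta C D H \<alpha> X \<in> Hom (Cat D) (FObj (comp_functor H (Omega_functor C)) X)
        (FObj (comp_functor (Omega_functor D) id_functor) X)"
      by (simp add: pt_Omega_simps zeta_hom)
  next
    fix m Y X assume "m \<in> Hom (op_cat (TopK C)) Y X"
    then have m: "m \<in> Hom (TopK C) X Y" by simp
    note m' = Hom_TopK_mono [OF m]
    have X: "in_TopK C X" and Y: "in_TopK C Y" using m by (auto simp: TopK_Hom_iff)
    let ?O = "FArr (Omega_functor C) m" and ?O' = "FArr (Omega_functor D) m"
    note O = C.Omega_map_hom [OF m] and O' = D.Omega_map_hom [OF m']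
    note HO = H.map_hom [OF O]
    have "Comp (Cat D) (zeta C D H \<alpha> X) (FArr H ?O) = Comp (Cat D) ?O' (zeta C D H \<alpha> Y)"
    proof (rule D.Omega_eqI [OF TopK_mono [OF X]])
      show "Comp (Cat D) (zeta C D H \<alpha> X) (FArr H ?O) \<in> Hom (Cat D) (FObj H (Omega C Y)) (Omega D X)"
        by (rule D.frames.source.comp_hom [OF HO zeta_hom [OF X]])
      show "Comp (Cat D) ?O' (zeta C D H \<alpha> Y) \<in> Hom (Cat D) (FObj H (Omega C Y)) (Omega D X)"
        by (rule D.frames.source.comp_hom [OF zeta_hom [OF Y] O'])
      fix a assume a: "a \<in> und_set D (FObj H (Omega C Y))"
      show "Theta D X (und_fun D (Comp (Cat D) (zeta C D H \<alpha> X) (FArr H ?O)) a) =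
          Theta D X (und_fun D (Comp (Cat D) ?O' (zeta C D H \<alpha> Y)) a)"
        unfolding D.und_fun_Comp [OF HO zeta_hom [OF X] a] D.und_fun_Comp [OF zeta_hom [OF Y] O' a]
          Theta_zeta [OF X D.und_fun_in [OF HO a]]
          D.Theta_Omega_map [OF m' D.und_fun_in [OF zeta_hom [OF Y] a]] Theta_zeta [OF Y a]
          H_Theta_def alpha_natural [OF O a]
          C.Theta_Omega_map [OF m alpha_in [OF C.Omega_obj [OF Y] a]] ..
    qed
    then show "Comp (Cat D) (zeta C D H \<alpha> X) (FArr (comp_functor H (Omega_functor C)) m) =
        Comp (Cat D) (FArr (comp_functor (Omega_functor D) id_functor) m) (zeta C D H \<alpha> Y)"
      by simp
  qed
qed

lemma H_point_hom:
  "f \<in> Hom (Cat C) c (Two C) \<Longrightarrow> Comp (Cat D) i (FArr H f) \<in> Hom (Cat D) (FObj H c) (Two D)"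
  by (rule D.frames.source.comp_hom [OF H.map_hom i_hom])

lemma Iota_H_point:
  assumes f: "f \<in> Hom (Cat C) c (Two C)" and b: "b \<in> und_set D (FObj H c)"
  shows "Iota D (und_fun D (Comp (Cat D) i (FArr H f)) b) = Iota C (und_fun C f (cfun (\<alpha> c) b))"
  unfolding D.und_fun_Comp [OF H.map_hom [OF f] i_hom b]
    Iota_i [OF D.und_fun_in [OF H.map_hom [OF f] b]] alpha_natural [OF f b] ..

lemma xi_hom:
  assumes c: "c \<in> Obj (Cat C)"
  shows "xi C D H i c \<in> Hom (TopK D) (pt C c) (pt D (FObj H c))"
proof -
  note Hc = H.map_obj [OF c]
  let ?g = "\<lambda>f \<in> Hom (Cat C) c (Two C). Comp (Cat D) i (FArr H f)"
  have "continuous_map (pt C c) (pt D (FObj H c)) ?g"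
    unfolding D.continuous_map_pt_iff [OF Hc]
  proof (intro conjI ballI)
    show "?g \<in> topspace (pt C c) \<rightarrow> Hom (Cat D) (FObj H c) (Two D)"
      using H_point_hom by (auto simp: C.topspace_pt [OF c])
    fix b assume b: "b \<in> und_set D (FObj H c)"
    have "{f \<in> topspace (pt C c). Iota D (und_fun D (?g f) b)} =
        {f \<in> Hom (Cat C) c (Two C). Iota C (und_fun C f (cfun (\<alpha> c) b))}"
      by (auto simp: C.topspace_pt [OF c] Iota_H_point [OF _ b])
    then show "openin (pt C c) {f \<in> topspace (pt C c). Iota D (und_fun D (?g f) b)}"
      using alpha_in [OF c b] unfolding C.openin_pt_iff [OF c] by blast
  qed
  then show ?thesis
    by (simp add: xi_def TopK_Hom_iff TopK_mono [OF C.pt_in_TopK [OF c]] D.pt_in_TopK [OF Hc]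
        C.topspace_pt [OF c])
qed

lemma cfun_xi:
  "f \<in> Hom (Cat C) c (Two C) \<Longrightarrow> cfun (xi C D H i c) f = Comp (Cat D) i (FArr H f)"
  by (simp add: xi_def)

lemma nat_trans_xi:
  "nat_trans (Cat C) (op_cat (TopK D)) (comp_functor (pt_functor D) H)
     (comp_functor id_functor (pt_functor C)) (xi C D H i)"
proof -
  interpret T: category "TopK D" by (rule category_TopK)
  interpret PH: is_functor "Cat C" "op_cat (TopK D)" "comp_functor (pt_functor D) H"
    by (rule is_functor_comp [OF H.is_functor_axioms D.is_functor_pt])
  interpret IP: is_functor "Cat C" "op_cat (TopK D)" "comp_functor id_functor (pt_functor C)"
    by (rule is_functor_comp [OF C.is_functor_pt is_functor_inclusion])
  show ?thesis
  proof
    fix c assume "c \<in> Obj (Cat C)"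
    then show "xi C D H i c \<in> Hom (op_cat (TopK D)) (FObj (comp_functor (pt_functor D) H) c)
        (FObj (comp_functor id_functor (pt_functor C)) c)"
      by (simp add: xi_hom pt_Omega_simps)
  next
    fix p c d assume p: "p \<in> Hom (Cat C) c d"
    have c: "c \<in> Obj (Cat C)" and d: "d \<in> Obj (Cat C)"
      using C.frames.source.Hom_obj [OF p] by auto
    note Hp = H.map_hom [OF p]
    note P = Hom_TopK_mono [OF C.pt_map_hom [OF p]] and P' = D.pt_map_hom [OF Hp]
    have "Comp (TopK D) (FArr (pt_functor D) (FArr H p)) (xi C D H i d) =
        Comp (TopK D) (xi C D H i c) (FArr (pt_functor C) p)"
    proof (rule TopK_eqI [OF T.comp_hom [OF xi_hom [OF d] P'] T.comp_hom [OF P xi_hom [OF c]]])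
      fix f assume f: "f \<in> topspace (pt C d)"
      then have f': "f \<in> Hom (Cat C) d (Two C)" by (simp add: C.topspace_pt [OF d])
      show "cfun (Comp (TopK D) (FArr (pt_functor D) (FArr H p)) (xi C D H i d)) f =
          cfun (Comp (TopK D) (xi C D H i c) (FArr (pt_functor C) p)) f"
        unfolding cfun_Comp_TopK [OF xi_hom [OF d] f] cfun_Comp_TopK [OF P f]
          cfun_xi [OF f'] C.cfun_pt_map [OF p f'] D.cfun_pt_map [OF Hp H_point_hom [OF f']]
          cfun_xi [OF C.frames.source.comp_hom [OF p f']] H.map_comp [OF p f']
          D.frames.source.comp_assoc [OF Hp H.map_hom [OF f'] i_hom] ..
    qed
    then show "Comp (op_cat (TopK D)) (xi C D H i d) (FArr (comp_functor (pt_functor D) H) p) =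
        Comp (op_cat (TopK D)) (FArr (comp_functor id_functor (pt_functor C)) p) (xi C D H i c)"
      unfolding op_cat_simps comp_functor_simps id_functor_simps .
  qed
qed

text \<open>The mate condition, read in \<open>Top\<close>: both sides send \<open>f\<close> to a point of \<open>H c\<close> whose value at
  \<open>b\<close> is \<open>\<iota> (f (\<alpha> b))\<close>.\<close>

lemma xi_mate_zeta:
  assumes c: "c \<in> Obj (Cat C)"
  shows "xi C D H i c = Comp (TopK D)
    (Comp (TopK D) (FArr (pt_functor D) (FArr H (eta C c))) (FArr (pt_functor D) (zeta C D H \<alpha> (pt C c))))
    (sigma D (pt C c))"
proof -
  interpret T: category "TopK D" by (rule category_TopK)
  note X = C.pt_in_TopK [OF c]
  note X' = TopK_mono [OF X]
  note e = C.eta_hom [OF c]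
  note He = H.map_hom [OF e]
  note z = zeta_hom [OF X]
  note s = D.sigma_hom [OF X']
  note pe = D.pt_map_hom [OF He] and pz = D.pt_map_hom [OF z]
  show ?thesis
  proof (rule TopK_eqI [OF xi_hom [OF c] T.comp_hom [OF s T.comp_hom [OF pz pe]]])
    fix f assume f: "f \<in> topspace (pt C c)"
    then have f': "f \<in> Hom (Cat C) c (Two C)" by (simp add: C.topspace_pt [OF c])
    note chi = D.chi_bar_hom [OF X' f]
    note chi_z = D.frames.source.comp_hom [OF z chi]
    note chi_z_e = D.frames.source.comp_hom [OF He chi_z]
    have "Comp (Cat D) i (FArr H f) =
        Comp (Cat D) (Comp (Cat D) (chi_bar D (pt C c) f) (zeta C D H \<alpha> (pt C c))) (FArr H (eta C c))"
    proof (rule D.point_eqI [OF H_point_hom [OF f'] chi_z_e])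
      fix b assume b: "b \<in> und_set D (FObj H c)"
      note eb = D.und_fun_in [OF He b]
      show "Iota D (und_fun D (Comp (Cat D) i (FArr H f)) b) = Iota D (und_fun D (Comp (Cat D)
          (Comp (Cat D) (chi_bar D (pt C c) f) (zeta C D H \<alpha> (pt C c))) (FArr H (eta C c))) b)"
        unfolding Iota_H_point [OF f' b] D.und_fun_Comp [OF He chi_z b] D.und_fun_Comp [OF z chi eb]
          D.Iota_chi_bar [OF X' f D.und_fun_in [OF z eb]] Theta_zeta [OF X eb]
          H_Theta_def alpha_natural [OF e b] C.Theta_eta [OF c alpha_in [OF c b]]
        using f' by simp
    qed
    moreover have "cfun (sigma D (pt C c)) f \<in> topspace (pt D (Omega D (pt C c)))"
      by (rule Hom_TopK_in [OF s f])
    ultimately show "cfun (xi C D H i c) f = cfun (Comp (TopK D)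
        (Comp (TopK D) (FArr (pt_functor D) (FArr H (eta C c))) (FArr (pt_functor D) (zeta C D H \<alpha> (pt C c))))
        (sigma D (pt C c))) f"
      unfolding cfun_Comp_TopK [OF s f] cfun_xi [OF f']
      by (simp only: cfun_Comp_TopK [OF pz] D.cfun_sigma [OF f] D.cfun_pt_map [OF z chi]
          D.cfun_pt_map [OF He chi_z])
  qed
qed

lemma right_adjunction_morphism_pt_Omega:
  "right_adjunction_morphism (pt_Omega C) (pt_Omega D) H id_functor (zeta C D H \<alpha>) (xi C D H i)"
  unfolding right_adjunction_morphism_def mate_pair_def pt_Omega_simps
    op_cat_simps id_functor_simps
  using C.adjunction_pt_Omega D.adjunction_pt_Omega H.is_functor_axioms is_functor_inclusion
    nat_trans_zeta nat_trans_xi xi_mate_zeta iso_zeta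
  by (simp del: TopK_simps(2,3))

end

theorem proposition2p12:
  fixes C :: "('o, 'u, 'f) sfc" and D :: "('p, 'u, 'f) sfc"
    and H :: "('o, 'u, 'p, 'u) cfunctor"
    and \<alpha> :: "'o \<Rightarrow> ('f gorder, 'f) cmor" and i :: 'u
  assumes "sfc_category C" and "sfc_category D" and "sfc_functor C D H \<alpha> i"
  shows "(\<forall>X \<in> Obj (TopK C).
            lifts (Cat D) (und D) (FObj H (Omega C X)) (Omega D X) (zeta_fun C D H \<alpha> X)) \<and>
         right_adjunction_morphism (pt_Omega C) (pt_Omega D)
           H id_functor (zeta C D H \<alpha>) (xi C D H i)"
proof -
  interpret sfc_fun C D H \<alpha> i
    using assms by unfold_locales
  show ?thesis
    using lifts_zeta right_adjunction_morphism_pt_Omega by simp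
qed

end
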